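(* Let $a,b>0$, and let $\mathcal{F}_1,\mathcal{F}_2,\mathcal{F}_3$ be the free linkages in the plane with length vectors $(a,b)$, $(r_1,\ldots,r_{n_2})$ and $(r_1',\ldots,r_{n_3}')$ respectively, where $n_2,n_3\ge 2$, the length range of $\mathcal{F}_2$ contains $[\,|a-b|,a+b\,]$, and the length range of $\mathcal{F}_3$ contains $[\,|a-b|,a+b\,]$. Let $$P'=|a-b|+\sum_{k=1}^{n_2}r_k,\qquad P''=|a-b|+\sum_{k=1}^{n_3}r_k'.$$ Let $r_i$ and $r_j$ be the two longest edges in $\mathcal{F}_2$, and let $r_{i}'$ and $r_{j}'$ denote the two longest edges in $\mathcal{F}_3$. Suppose that $r_i+r_j\le P'/2$ and $r_{i}'+r_{j}'\le P''/2$. Then the moduli space $M(\mathcal{F}_1,\mathcal{F}_2,\mathcal{F}_3)$ is connected.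
   Context: A free linkage $\mathcal{F}$ in $\mathbb{R}^2$ with length vector $(d_1,\ldots,d_n)$, $d_i>0$, has configurations $(x_1,\ldots,x_{n+1})\in(\mathbb{R}^2)^{n+1}$ with $|x_i-x_{i+1}|=d_i$ for $i=1,\ldots,n$; $x_1$ is the initial and $x_{n+1}$ the terminal vertex. $C(\mathcal{F}_1,\mathcal{F}_2,\mathcal{F}_3)$ is the space of triples of configurations of $\mathcal{F}_1,\mathcal{F}_2,\mathcal{F}_3$ with all initial vertices at the origin and all terminal vertices coinciding, and $M(\mathcal{F}_1,\mathcal{F}_2,\mathcal{F}_3)=C(\mathcal{F}_1,\mathcal{F}_2,\mathcal{F}_3)/SO(2)$. The length range of a free linkage is the closed interval $[l_1,l_2]$, where $l_1$ is the minimum of $|x_{n+1}-x_1|$ over all its configurations and $l_2=\sum_{i=1}^n d_i$. "Two longest edges" means two edges with distinct positions in the linkage such that no other edge is longer than either of them. The indices $i,j$ for $\mathcal{F}_2$ and for $\mathcal{F}_3$ are chosen independently. *)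

theory Defs
  imports "HOL-Analysis.Analysis"
begin

text \<open>
  A free linkage is given by its list of edge lengths \<open>d\<close>. Vertices are numbered
  \<open>0, \<dots>, length d\<close>, so that edge \<open>d ! i\<close> joins the vertices \<open>i\<close> and \<open>Suc i\<close>;
  vertex \<open>0\<close> is the initial and vertex \<open>length d\<close> the terminal one. A tuple of vertices is
  an extensional function on \<open>{0..length d}\<close>, and the spaces carry the product topology.
\<close>

definition free_linkage :: "real list \<Rightarrow> bool" where
  "free_linkage d \<longleftrightarrow> d \<noteq> [] \<and> (\<forall>l\<in>set d. 0 < l)"

definition configurations :: "real list \<Rightarrow> (nat \<Rightarrow> real^2) set" where
  "configurations d =
     {x \<in> {0..length d} \<rightarrow>\<^sub>E UNIV. \<forall>i<length d. dist (x i) (x (Suc i)) = d ! i}"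

text \<open>On \<open>real\<close>, \<open>LEAST\<close> denotes the minimum of a set that has one; the distances below
  form a nonempty compact set.\<close>

definition length_range :: "real list \<Rightarrow> real set" where
  "length_range d =
     {(LEAST l. \<exists>x\<in>configurations d. l = dist (x (length d)) (x 0)) .. sum_list d}"

definition two_longest_edges :: "real list \<Rightarrow> nat \<Rightarrow> nat \<Rightarrow> bool" where
  "two_longest_edges d i j \<longleftrightarrow>
     i < length d \<and> j < length d \<and> i \<noteq> j \<and>
     (\<forall>k<length d. k \<noteq> i \<and> k \<noteq> j \<longrightarrow> d ! k \<le> d ! i \<and> d ! k \<le> d ! j)"

type_synonym conf_triple = "(nat \<Rightarrow> real^2) \<times> (nat \<Rightarrow> real^2) \<times> (nat \<Rightarrow> real^2)"

definition vertex_topology :: "real list \<Rightarrow> (nat \<Rightarrow> real^2) topology" where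
  "vertex_topology d = product_topology (\<lambda>_. euclidean) {0..length d}"

definition C_set :: "real list \<Rightarrow> real list \<Rightarrow> real list \<Rightarrow> conf_triple set" where
  "C_set d1 d2 d3 =
     {(x, y, z). x \<in> configurations d1 \<and> y \<in> configurations d2 \<and> z \<in> configurations d3 \<and>
        x 0 = 0 \<and> y 0 = 0 \<and> z 0 = 0 \<and>
        x (length d1) = y (length d2) \<and> y (length d2) = z (length d3)}"

definition C_space :: "real list \<Rightarrow> real list \<Rightarrow> real list \<Rightarrow> conf_triple topology" where
  "C_space d1 d2 d3 =
     subtopology
       (prod_topology (vertex_topology d1)
         (prod_topology (vertex_topology d2) (vertex_topology d3)))
       (C_set d1 d2 d3)"

definition SO2 :: "(real^2^2) set" where
  "SO2 = {A. rotation_matrix A}"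

text \<open>\<open>A\<close> acts on every vertex; \<open>restrict\<close> keeps the functions extensional.\<close>

definition rotate_conf :: "real list \<Rightarrow> real^2^2 \<Rightarrow> (nat \<Rightarrow> real^2) \<Rightarrow> (nat \<Rightarrow> real^2)" where
  "rotate_conf d A x = restrict (\<lambda>i. A *v x i) {0..length d}"

definition SO2_orbit :: "real list \<Rightarrow> real list \<Rightarrow> real list \<Rightarrow> conf_triple \<Rightarrow> conf_triple set" where
  "SO2_orbit d1 d2 d3 =
     (\<lambda>(x, y, z). {(rotate_conf d1 A x, rotate_conf d2 A y, rotate_conf d3 A z) | A. A \<in> SO2})"

definition quotient_topology :: "'a topology \<Rightarrow> ('a \<Rightarrow> 'b) \<Rightarrow> 'b topology" where
  "quotient_topology X q =
     topology (\<lambda>U. U \<subseteq> q ` topspace X \<and> openin X {x \<in> topspace X. q x \<in> U})"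

lemma openin_quotient_topology:
  "openin (quotient_topology X q) U \<longleftrightarrow>
     U \<subseteq> q ` topspace X \<and> openin X {x \<in> topspace X. q x \<in> U}"
proof -
  have Int: "{x \<in> topspace X. q x \<in> S \<inter> T} =
      {x \<in> topspace X. q x \<in> S} \<inter> {x \<in> topspace X. q x \<in> T}" for S T
    by auto
  have Un: "{x \<in> topspace X. q x \<in> \<Union>K} = \<Union> ((\<lambda>S. {x \<in> topspace X. q x \<in> S}) ` K)" for K
    by auto
  have "istopology (\<lambda>U. U \<subseteq> q ` topspace X \<and> openin X {x \<in> topspace X. q x \<in> U})"
    unfolding istopology_def Int Un
  proof (intro conjI allI impI)
    fix S T
    assume "S \<subseteq> q ` topspace X \<and> openin X {x \<in> topspace X. q x \<in> S}"
      and "T \<subseteq> q ` topspace X \<and> openin X {x \<in> topspace X. q x \<in> T}"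
    then show "S \<inter> T \<subseteq> q ` topspace X"
      and "openin X ({x \<in> topspace X. q x \<in> S} \<inter> {x \<in> topspace X. q x \<in> T})"
      by (simp_all only: openin_Int le_infI1)
  next
    fix K
    assume K: "\<forall>S\<in>K. S \<subseteq> q ` topspace X \<and> openin X {x \<in> topspace X. q x \<in> S}"
    show "\<Union>K \<subseteq> q ` topspace X"
      by (rule Union_least) (use K in simp)
    show "openin X (\<Union> ((\<lambda>S. {x \<in> topspace X. q x \<in> S}) ` K))"
      by (rule openin_Union) (use K in \<open>simp only: ball_simps image_iff, metis\<close>)
  qed
  then show ?thesis
    unfolding quotient_topology_def by (simp only: topology_inverse')
qed

lemma topspace_quotient_topology: "topspace (quotient_topology X q) = q ` topspace X"
proof (rule subset_antisym)
  show "topspace (quotient_topology X q) \<subseteq> q ` topspace X"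
    by (rule conjunct1[OF openin_quotient_topology[THEN iffD1, OF openin_topspace]])
  have "{x \<in> topspace X. q x \<in> q ` topspace X} = topspace X"
    by auto
  then have "openin (quotient_topology X q) (q ` topspace X)"
    by (simp only: openin_quotient_topology openin_topspace subset_refl simp_thms)
  then show "q ` topspace X \<subseteq> topspace (quotient_topology X q)"
    by (rule openin_subset)
qed

lemma quotient_map_quotient_topology: "quotient_map X (quotient_topology X q) q"
  unfolding quotient_map_def
proof (intro conjI allI impI)
  show "q ` topspace X = topspace (quotient_topology X q)"
    by (rule topspace_quotient_topology[symmetric])
next
  fix U
  assume "U \<subseteq> topspace (quotient_topology X q)"
  then show "openin X {x \<in> topspace X. q x \<in> U} \<longleftrightarrow> openin (quotient_topology X q) U"
    by (simp only: openin_quotient_topology topspace_quotient_topology simp_thms)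
qed

definition M_space :: "real list \<Rightarrow> real list \<Rightarrow> real list \<Rightarrow> conf_triple set topology" where
  "M_space d1 d2 d3 = quotient_topology (C_space d1 d2 d3) (SO2_orbit d1 d2 d3)"

end

theory Submission
  imports Defs
begin

text \<open>
  \<^bold>\<open>Reduction.\<close> A quotient of a connected space is connected, so it is enough to show that the space of
  configuration triples is connected. That space projects to the configurations of the first
  linkage, which form a torus. Over a configuration whose terminal vertex is \<open>z\<close>, the fibre is the
  product of the two spaces of chains with edge lengths \<open>r\<close>, resp. \<open>r'\<close>, that run from the origin to
  \<open>z\<close>. The fibres are nonempty because \<open>\<bar>z\<bar>\<close> lies in \<open>{\<bar>a - b\<bar>..a + b}\<close>, which is contained in both
  length ranges. If a compact space maps continuously onto a connected Hausdorff space with connected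
  fibres, then it is connected (\<open>connected_modulo_fibration\<close>), so everything rests on the
  connectedness of the space of chains from \<open>0\<close> to \<open>z\<close>.

  \<^bold>\<open>Planar polygons.\<close> A chain from \<open>0\<close> to \<open>z\<close> with edges \<open>l\<close> is a closed polygon with edges \<open>l\<close> and
  \<open>\<rho> = \<bar>z\<bar>\<close>. Such polygons form a connected space as soon as no three edges are pairwise longer
  together than half of the perimeter. Here this holds since any two edges of \<open>r\<close> have
  total length at most \<open>(\<bar>a - b\<bar> + \<Sum> r) / 2 \<le> (\<rho> + \<Sum> r) / 2\<close>.

  \<^bold>\<open>Induction on the number of edges.\<close> Cut the polygon along the diagonal that spans the two longest
  edges \<open>p\<close> and \<open>q\<close> of \<open>l\<close>. This yields a triangle with sides \<open>p\<close>, \<open>q\<close>, \<open>d\<close> and a chain in which \<open>p\<close>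
  and \<open>q\<close> are replaced by the single edge \<open>d\<close>. The length \<open>d\<close> ranges over an interval. Each of the
  two pieces may be reflected independently of the other. First, \<open>connected_modulo_chains\<close>
  shows that the space of chains has no nontrivial clopen subset invariant under reflection.
  Here one uses that at the largest value of \<open>d\<close> one of the pieces is straight, hence
  fixed by its own reflection. For \<open>connected_chains\<close> both reflections must be absorbed. This happens
  if both the triangle and the chain become straight at suitable values of \<open>d\<close>, or if the triangle
  is straight for \<open>d = p + q\<close> and the chain with the edge \<open>p + q\<close> again has no long triple
  (\<open>no_long_triple_merge\<close>), so that the induction hypothesis joins it to its mirror image. A case
  distinction on \<open>p + q\<close> shows that one of these situations always occurs.
\<close>

section \<open>Connectedness modulo a set of maps\<close>

text \<open>
  For a compact \<open>X\<close> mapped to itself by \<open>G\<close>, this says that the quotient of \<open>X\<close> by the equivalence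
  relation generated by \<open>G\<close> is connected. No group structure on \<open>G\<close> is required, which makes it easy
  to remove generators one at a time.
\<close>
definition connected_modulo :: "('a::topological_space \<Rightarrow> 'a) set \<Rightarrow> 'a set \<Rightarrow> bool" where
  "connected_modulo G X \<longleftrightarrow>
     (\<forall>U V. closed U \<and> closed V \<and> U \<union> V = X \<and> U \<inter> V = {} \<and>
        (\<forall>g\<in>G. g ` U \<subseteq> U \<and> g ` V \<subseteq> V) \<longrightarrow> U = {} \<or> V = {})"

lemma connected_moduloI:
  assumes "\<And>U V. closed U \<Longrightarrow> closed V \<Longrightarrow> U \<union> V = X \<Longrightarrow> U \<inter> V = {} \<Longrightarrow>
    (\<And>g x. g \<in> G \<Longrightarrow> x \<in> U \<Longrightarrow> g x \<in> U) \<Longrightarrow> (\<And>g x. g \<in> G \<Longrightarrow> x \<in> V \<Longrightarrow> g x \<in> V) \<Longrightarrow>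
    U = {} \<or> V = {}"
  shows "connected_modulo G X"
  unfolding connected_modulo_def
proof (intro allI impI, elim conjE)
  fix U V
  assume *: "closed U" "closed V" "U \<union> V = X" "U \<inter> V = {}"
    and inv: "\<forall>g\<in>G. g ` U \<subseteq> U \<and> g ` V \<subseteq> V"
  show "U = {} \<or> V = {}"
    by (rule assms[OF *]) (use inv in blast)+
qed

lemma connected_moduloD:
  assumes "connected_modulo G X" "closed U" "closed V" "U \<union> V = X" "U \<inter> V = {}"
    "\<And>g x. g \<in> G \<Longrightarrow> x \<in> U \<Longrightarrow> g x \<in> U" "\<And>g x. g \<in> G \<Longrightarrow> x \<in> V \<Longrightarrow> g x \<in> V"
  shows "U = {} \<or> V = {}"
proof -
  have "\<forall>g\<in>G. g ` U \<subseteq> U \<and> g ` V \<subseteq> V"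
    using assms(6,7) by blast
  then show ?thesis
    using assms(1-5) unfolding connected_modulo_def by simp
qed

lemma connected_modulo_empty_iff:
  "closed X \<Longrightarrow> connected_modulo {} X \<longleftrightarrow> connected X"
  by (auto simp: connected_modulo_def connected_closed_set)

text \<open>
  A set that is invariant under \<open>H\<close> is invariant under products of elements of \<open>H\<close>. Products of
  two suffice for passing between the generating sets of the group of order four generated by two
  commuting reflections.
\<close>
lemma connected_modulo_mono:
  assumes "connected_modulo G X"
    and "\<And>g. g \<in> G \<Longrightarrow> (\<exists>h\<in>H. \<exists>h'\<in>H. \<forall>x\<in>X. g x = h (h' x)) \<or> (\<exists>h\<in>H. \<forall>x\<in>X. g x = h x)"
  shows "connected_modulo H X"
proof (rule connected_moduloI)
  fix U V
  assume UV: "closed U" "closed V" "U \<union> V = X" "U \<inter> V = {}"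
    and U: "\<And>g x. g \<in> H \<Longrightarrow> x \<in> U \<Longrightarrow> g x \<in> U" and V: "\<And>g x. g \<in> H \<Longrightarrow> x \<in> V \<Longrightarrow> g x \<in> V"
  show "U = {} \<or> V = {}"
  proof (rule connected_moduloD[OF assms(1) UV])
    fix g x assume g: "g \<in> G" and x: "x \<in> U"
    show "g x \<in> U" using assms(2)[OF g] x U UV(3) by (metis Un_iff)
  next
    fix g x assume g: "g \<in> G" and x: "x \<in> V"
    show "g x \<in> V" using assms(2)[OF g] x V UV(3) by (metis Un_iff)
  qed
qed

lemma connected_modulo_image:
  fixes f :: "'a::topological_space \<Rightarrow> 'b::topological_space"
  assumes X: "connected_modulo G X" "closed X" and f: "continuous_on X f"
    and maps: "\<And>g x. g \<in> G \<Longrightarrow> x \<in> X \<Longrightarrow> g x \<in> X"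
    and equi: "\<And>g. g \<in> G \<Longrightarrow> \<exists>h\<in>H. \<forall>x\<in>X. f (g x) = h (f x)"
  shows "connected_modulo H (f ` X)"
proof (rule connected_moduloI)
  fix U V
  assume UV: "closed U" "closed V" "U \<union> V = f ` X" "U \<inter> V = {}"
    and U: "\<And>g x. g \<in> H \<Longrightarrow> x \<in> U \<Longrightarrow> g x \<in> U" and V: "\<And>g x. g \<in> H \<Longrightarrow> x \<in> V \<Longrightarrow> g x \<in> V"
  have "X \<inter> f -` U = {} \<or> X \<inter> f -` V = {}"
  proof (rule connected_moduloD[OF X(1)])
    show "closed (X \<inter> f -` U)" "closed (X \<inter> f -` V)"
      using continuous_closed_preimage[OF f X(2)] UV(1,2) by blast+
    show "X \<inter> f -` U \<union> X \<inter> f -` V = X" "X \<inter> f -` U \<inter> (X \<inter> f -` V) = {}"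
      using UV(3,4) by auto
  next
    fix g x assume g: "g \<in> G" and x: "x \<in> X \<inter> f -` U"
    obtain h where h: "h \<in> H" and hx: "\<forall>x\<in>X. f (g x) = h (f x)"
      using equi[OF g] by (elim bexE)
    have "g x \<in> X" by (rule maps[OF g]) (use x in simp)
    then show "g x \<in> X \<inter> f -` U" using U[OF h, of "f x"] hx x by simp
  next
    fix g x assume g: "g \<in> G" and x: "x \<in> X \<inter> f -` V"
    obtain h where h: "h \<in> H" and hx: "\<forall>x\<in>X. f (g x) = h (f x)"
      using equi[OF g] by (elim bexE)
    have "g x \<in> X" by (rule maps[OF g]) (use x in simp)
    then show "g x \<in> X \<inter> f -` V" using V[OF h, of "f x"] hx x by simp
  qed
  moreover have "U \<subseteq> f ` X" "V \<subseteq> f ` X"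
    using UV(3) by auto
  ultimately show "U = {} \<or> V = {}"
    by auto
qed

text \<open>
  An invariant closed partition of \<open>K\<close> cannot cut through a fibre, so the images of its two parts are
  disjoint. By compactness they are closed, hence they form an invariant partition of the base.
\<close>
lemma connected_modulo_fibration:
  fixes f :: "'a::t2_space \<Rightarrow> 'b::t2_space"
  assumes K: "compact K" and f: "continuous_on K f" and base: "connected_modulo H (f ` K)"
    and lift: "\<And>h. h \<in> H \<Longrightarrow> \<exists>g\<in>G. \<forall>x\<in>K. f (g x) = h (f x)"
    and fibres: "\<And>b. b \<in> f ` K \<Longrightarrow> connected_modulo F {x \<in> K. f x = b}"
    and F: "F \<subseteq> G" "\<And>g x. g \<in> F \<Longrightarrow> x \<in> K \<Longrightarrow> f (g x) = f x"
  shows "connected_modulo G K"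
proof (rule connected_moduloI)
  fix U V
  assume UV: "closed U" "closed V" "U \<union> V = K" "U \<inter> V = {}"
    and U: "\<And>g x. g \<in> G \<Longrightarrow> x \<in> U \<Longrightarrow> g x \<in> U" and V: "\<And>g x. g \<in> G \<Longrightarrow> x \<in> V \<Longrightarrow> g x \<in> V"
  have UK: "U = K \<inter> U" and VK: "V = K \<inter> V" using UV(3) by auto
  have cl: "closed (f ` W)" if "closed W" "W \<subseteq> K" for W
  proof -
    have "compact W" using compact_Int_closed[OF K that(1)] that(2) by (simp add: inf_absorb2)
    then show ?thesis
      using compact_continuous_image[OF continuous_on_subset[OF f that(2)]] compact_imp_closed by blast
  qed
  have "f ` U \<inter> f ` V = {}"
  proof (rule ccontr)
    assume "f ` U \<inter> f ` V \<noteq> {}"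
    then obtain x y where xy: "x \<in> U" "y \<in> V" "f x = f y" by blast
    let ?B = "{z \<in> K. f z = f x}"
    have "U \<inter> ?B = {} \<or> V \<inter> ?B = {}"
    proof (rule connected_moduloD[OF fibres])
      show "f x \<in> f ` K" using xy UV(3) by blast
      have "closed (K \<inter> f -` {f x})"
        using continuous_closed_preimage[OF f compact_imp_closed[OF K]] by blast
      then have "closed ?B" by (simp add: vimage_def Int_def)
      then show "closed (U \<inter> ?B)" "closed (V \<inter> ?B)" using UV(1,2) by auto
      show "U \<inter> ?B \<union> V \<inter> ?B = ?B" "U \<inter> ?B \<inter> (V \<inter> ?B) = {}" using UV(3,4) by auto
    next
      fix g z assume g: "g \<in> F" and z: "z \<in> U \<inter> ?B"
      have "g z \<in> U" by (rule U) (use g z F(1) in auto)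
      then show "g z \<in> U \<inter> ?B" using F(2)[OF g, of z] z UV(3) by auto
    next
      fix g z assume g: "g \<in> F" and z: "z \<in> V \<inter> ?B"
      have "g z \<in> V" by (rule V) (use g z F(1) in auto)
      then show "g z \<in> V \<inter> ?B" using F(2)[OF g, of z] z UV(3) by auto
    qed
    then show False using xy UV(3) by auto
  qed
  note disj = this
  have closed: "closed (f ` U)" "closed (f ` V)" using cl UV by auto
  have cover: "f ` U \<union> f ` V = f ` K" using UV(3) by auto
  have invU: "h y \<in> f ` U" if h: "h \<in> H" and y: "y \<in> f ` U" for h y
  proof -
    obtain x where "x \<in> U" "y = f x" using y by blast
    moreover obtain g where "g \<in> G" "\<forall>x\<in>K. f (g x) = h (f x)" using lift[OF h] by blast
    ultimately show ?thesis using U UK by (metis Int_iff imageI)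
  qed
  have invV: "h y \<in> f ` V" if h: "h \<in> H" and y: "y \<in> f ` V" for h y
  proof -
    obtain x where "x \<in> V" "y = f x" using y by blast
    moreover obtain g where "g \<in> G" "\<forall>x\<in>K. f (g x) = h (f x)" using lift[OF h] by blast
    ultimately show ?thesis using V VK by (metis Int_iff imageI)
  qed
  have "f ` U = {} \<or> f ` V = {}"
    by (rule connected_moduloD[OF base closed cover disj]) (fact invU, fact invV)
  then show "U = {} \<or> V = {}" by simp
qed

text \<open>
  If an invariant clopen set \<open>U\<close> contains the connected set \<open>C\<close> through \<open>x\<close> and \<open>g x\<close>, then
  \<open>U \<inter> g -` U\<close> is still nonempty, and it is invariant under \<open>g\<close> as well. Hence it is everything: one point
  that cannot be separated from its image under \<open>g\<close> makes \<open>g\<close> superfluous.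
\<close>
lemma connected_modulo_absorb:
  assumes X: "connected_modulo (insert g G) X" "closed X"
    and g: "continuous_on X g" "\<And>x. x \<in> X \<Longrightarrow> g x \<in> X" "\<And>x. x \<in> X \<Longrightarrow> g (g x) = x"
    and comm: "\<And>h x. h \<in> G \<Longrightarrow> x \<in> X \<Longrightarrow> h x \<in> X" "\<And>h x. h \<in> G \<Longrightarrow> x \<in> X \<Longrightarrow> g (h x) = h (g x)"
    and C: "connected C" "C \<subseteq> X" "x \<in> C" "g x \<in> C"
  shows "connected_modulo G X"
proof -
  have main: "V = {}"
    if UV: "closed U" "closed V" "U \<union> V = X" "U \<inter> V = {}" and xU: "x \<in> U"
      and U: "\<And>h x. h \<in> G \<Longrightarrow> x \<in> U \<Longrightarrow> h x \<in> U" and V: "\<And>h x. h \<in> G \<Longrightarrow> x \<in> V \<Longrightarrow> h x \<in> V"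
    for U V
  proof -
    let ?A = "U \<inter> (X \<inter> g -` U)" and ?B = "V \<union> (X \<inter> g -` V)"
    have gC: "g x \<in> U"
    proof (rule ccontr)
      assume "g x \<notin> U"
      then have "g x \<in> V \<inter> C" using C UV(3) by blast
      then show False using connected_closedD[OF C(1) _ _ UV(1,2)] C UV(3,4) xU by blast
    qed
    have "?A = {} \<or> ?B = {}"
    proof (rule connected_moduloD[OF X(1)])
      show "closed ?A" "closed ?B"
        using UV continuous_closed_preimage[OF g(1) X(2)] by auto
      show "?A \<union> ?B = X" "?A \<inter> ?B = {}"
        using UV(3,4) g(2) by blast+
    next
      fix h y assume h: "h \<in> insert g G" and y: "y \<in> ?A"
      show "h y \<in> ?A"
      proof (cases "h \<in> G")
        case True
        then show ?thesis using y U[OF True] comm[OF True, of y] by auto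
      next
        case False
        then have "h = g" using h by simp
        then show ?thesis using y g(2,3)[of y] by auto
      qed
    next
      fix h y assume h: "h \<in> insert g G" and y: "y \<in> ?B"
      then have "y \<in> X" using UV(3) by auto
      show "h y \<in> ?B"
      proof (cases "h \<in> G")
        case True
        then show ?thesis using y V[OF True] comm[OF True \<open>y \<in> X\<close>] by auto
      next
        case False
        then have "h = g" using h by simp
        then show ?thesis using y g(2)[OF \<open>y \<in> X\<close>] g(3)[OF \<open>y \<in> X\<close>] by auto
      qed
    qed
    then show ?thesis using gC xU C by auto
  qed
  show ?thesis
  proof (rule connected_moduloI)
    fix U V
    assume UV: "closed U" "closed V" "U \<union> V = X" "U \<inter> V = {}"
      and U: "\<And>g x. g \<in> G \<Longrightarrow> x \<in> U \<Longrightarrow> g x \<in> U" and V: "\<And>g x. g \<in> G \<Longrightarrow> x \<in> V \<Longrightarrow> g x \<in> V"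
    have UV': "V \<union> U = X" "V \<inter> U = {}" using UV(3,4) by auto
    have "x \<in> U \<or> x \<in> V" using UV(3) C(2,3) by blast
    then show "U = {} \<or> V = {}"
    proof
      assume "x \<in> U"
      then have "V = {}" by (rule main[OF UV]) (fact U, fact V)
      then show ?thesis ..
    next
      assume "x \<in> V"
      then have "U = {}" by (rule main[OF UV(2,1) UV']) (fact V, fact U)
      then show ?thesis ..
    qed
  qed
qed

lemma compact_product:
  fixes A :: "'i \<Rightarrow> 'a::topological_space set"
  assumes "\<And>k. compact (A k)" shows "compact {u. \<forall>k. u k \<in> A k}"
proof -
  have "compactin (product_topology (\<lambda>_. euclidean) UNIV) (PiE UNIV A)"
    using assms by (simp add: compactin_PiE)
  moreover have "PiE UNIV A = {u. \<forall>k. u k \<in> A k}" by auto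
  ultimately show ?thesis by (simp add: euclidean_product_topology)
qed

lemma connected_product:
  fixes A :: "'i \<Rightarrow> 'a::topological_space set"
  assumes "\<And>k. connected (A k)" shows "connected {u. \<forall>k. u k \<in> A k}"
proof -
  have "connectedin (product_topology (\<lambda>_. euclidean) UNIV) (PiE UNIV A)"
    using assms by (simp add: connectedin_PiE)
  moreover have "PiE UNIV A = {u. \<forall>k. u k \<in> A k}" by auto
  ultimately show ?thesis by (simp add: euclidean_product_topology)
qed

section \<open>Unit directions, chains and triangles\<close>

lemma connected_imp_connected_modulo:
  "connected X \<Longrightarrow> closed X \<Longrightarrow> connected_modulo G X"
  by (rule connected_modulo_mono[of "{}"]) (auto simp: connected_modulo_empty_iff)

text \<open>
  The directions of the edges are unit complex numbers, one for every natural number. An edge set \<open>J\<close>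
  uses only the directions indexed by \<open>J\<close>. The others are free and contribute circle factors, which
  affects neither compactness nor connectedness and keeps the ambient space the same when edges are
  merged.
\<close>
definition torus :: "(nat \<Rightarrow> complex) set" where
  "torus = {u. \<forall>k. norm (u k) = 1}"

definition chain_space :: "nat set \<Rightarrow> (nat \<Rightarrow> real) \<Rightarrow> complex \<Rightarrow> (nat \<Rightarrow> complex) set" where
  "chain_space J l z = {u \<in> torus. (\<Sum>k\<in>J. of_real (l k) * u k) = z}"

definition cnj_dirs :: "(nat \<Rightarrow> complex) \<Rightarrow> nat \<Rightarrow> complex" where
  "cnj_dirs u = (\<lambda>k. cnj (u k))"

text \<open>
  Directions of the two sides \<open>a\<close>, \<open>b\<close> of a triangle whose third side is the segment from \<open>0\<close> to \<open>d\<close>.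
\<close>
definition triangles :: "real \<Rightarrow> real \<Rightarrow> real \<Rightarrow> (complex \<times> complex) set" where
  "triangles a b d =
     {(s, t). norm s = 1 \<and> norm t = 1 \<and> of_real a * s + of_real b * t = of_real d}"

text \<open>
  The distances that the chain \<open>J\<close> can leave open between its end and the point \<open>\<rho>\<close>, that is, the
  lengths of a further edge that closes the gap.
\<close>
definition gap_lengths :: "nat set \<Rightarrow> (nat \<Rightarrow> real) \<Rightarrow> real \<Rightarrow> real set" where
  "gap_lengths J l \<rho> = (\<lambda>u. norm (of_real \<rho> - (\<Sum>k\<in>J. of_real (l k) * u k))) ` torus"

lemma torus_eq: "torus = {u. \<forall>k. u k \<in> sphere 0 1}"
  by (simp add: torus_def)

lemma connected_circle: "connected (sphere (0::complex) 1)"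
  by (rule connected_sphere) simp

lemma compact_torus: "compact torus"
  unfolding torus_eq by (rule compact_product) simp

lemma connected_torus: "connected torus"
  unfolding torus_eq by (rule connected_product) (rule connected_circle)

lemma continuous_on_coordinate [continuous_intros]:
  "continuous_on S f \<Longrightarrow> continuous_on S (\<lambda>x. f x k :: 'b::topological_space)"
  by (rule continuous_on_compose2[OF continuous_on_product_coordinates[of k]]) auto

lemma compact_chains: "compact (chain_space J l z)"
proof -
  have "closed {u :: nat \<Rightarrow> complex. (\<Sum>k\<in>J. of_real (l k) * u k) = z}"
    by (intro closed_Collect_eq continuous_intros)
  then have "compact (torus \<inter> {u. (\<Sum>k\<in>J. of_real (l k) * u k) = z})"
    by (rule compact_Int_closed[OF compact_torus])
  then show ?thesis by (simp add: chain_space_def Int_def)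
qed

text \<open>
  A nondegenerate edge has at most one direction with the required end, an edge of length zero
  has all of them or none.
\<close>
lemma connected_multiples: "connected {c::complex. norm c = 1 \<and> of_real a * c = z}"
proof (cases "a = 0")
  case True
  then show ?thesis using connected_circle by (cases "z = 0") (auto simp: sphere_def)
next
  case False
  then have "{c. norm c = 1 \<and> of_real a * c = z} \<subseteq> {z / of_real a}"
    by (auto simp: field_simps)
  then have "{c. norm c = 1 \<and> of_real a * c = z} = {} \<or> {c. norm c = 1 \<and> of_real a * c = z} = {z / of_real a}"
    by (rule subset_singletonD)
  then show ?thesis by (elim disjE) (simp_all only: connected_empty connected_sing)
qed

lemma connected_chains_le_1:
  assumes "finite J" "card J \<le> 1"
  shows "connected (chain_space J l z)"
proof -
  have "J = {} \<or> (\<exists>k. J = {k})"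
    using assms by (metis One_nat_def card_1_singletonE card_eq_0_iff le_Suc_eq le_zero_eq)
  then consider "J = {}" | k where "J = {k}" by blast
  then show ?thesis
  proof cases
    case 1
    then show ?thesis using connected_torus by (cases "z = 0") (auto simp: chain_space_def)
  next
    case 2
    have "chain_space J l z = {u. \<forall>i. u i \<in> (if i = k then {c. norm c = 1 \<and> of_real (l k) * c = z} else sphere 0 1)}"
      unfolding 2 by (auto simp: chain_space_def torus_def split: if_splits)
    also have "connected \<dots>"
      using connected_multiples connected_circle by (intro connected_product) simp
    finally show ?thesis .
  qed
qed

text \<open>
  The distance from \<open>\<rho>\<close> varies continuously along the circle of radius \<open>a\<close>, from \<open>\<bar>\<rho> - a\<bar>\<close> to \<open>\<rho> + a\<close>.
\<close>
lemma circle_distance_surj: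
  fixes a \<rho> c :: real
  assumes "\<bar>\<rho> - a\<bar> \<le> c" "c \<le> \<rho> + a"
  shows "\<exists>t::complex. norm t = 1 \<and> norm (of_real \<rho> - of_real a * t) = c"
proof -
  let ?f = "\<lambda>t::complex. norm (of_real \<rho> - of_real a * t)"
  have conn: "connected (?f ` sphere 0 1)"
    by (intro connected_continuous_image continuous_intros connected_circle)
  have f1: "?f 1 = \<bar>\<rho> - a\<bar>"
    by (simp flip: of_real_diff)
  have f2: "?f (-1) = \<bar>\<rho> + a\<bar>"
    by (simp flip: of_real_add)
  have "?f 1 \<in> ?f ` sphere 0 1" "?f (-1) \<in> ?f ` sphere 0 1" by (rule imageI, simp)+
  then have "{\<bar>\<rho> - a\<bar>..\<bar>\<rho> + a\<bar>} \<subseteq> ?f ` sphere 0 1"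
    using connected_contains_Icc[OF conn, of "?f 1" "?f (-1)"] unfolding f1 f2 by blast
  then have "c \<in> ?f ` sphere 0 1"
    using assms by auto
  then show ?thesis by auto
qed

lemma triangles_nonempty_iff:
  assumes "0 \<le> a" "0 \<le> b" "0 \<le> d"
  shows "triangles a b d \<noteq> {} \<longleftrightarrow> \<bar>a - b\<bar> \<le> d \<and> d \<le> a + b"
proof
  assume "triangles a b d \<noteq> {}"
  then obtain s t where "(s, t) \<in> triangles a b d" by auto
  then have st: "norm s = 1" "norm t = 1" "of_real d = of_real a * s + of_real b * t"
    by (simp_all add: triangles_def)
  have ns: "norm (of_real a * s) = a" "norm (of_real b * t) = b"
    using st assms by (simp_all add: norm_mult)
  have "norm (complex_of_real d) \<le> a + b"
    using norm_triangle_ineq[of "of_real a * s" "of_real b * t"] ns st(3) by simp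
  moreover have "\<bar>a - b\<bar> \<le> norm (complex_of_real d)"
    using norm_triangle_ineq3[of "of_real a * s" "- (of_real b * t)"] ns st(3) by simp
  ultimately show "\<bar>a - b\<bar> \<le> d \<and> d \<le> a + b" using assms by simp
next
  assume d: "\<bar>a - b\<bar> \<le> d \<and> d \<le> a + b"
  have "\<bar>d - a\<bar> \<le> b" "b \<le> d + a" using d by auto
  from circle_distance_surj[OF this] obtain s :: complex
    where s: "norm s = 1" "norm (of_real d - of_real a * s) = b" by blast
  define t where "t = (if b = 0 then 1 else (of_real d - of_real a * s) / of_real b)"
  have "norm t = 1" "of_real b * t = of_real d - of_real a * s"
    using s assms(2) by (auto simp: t_def norm_divide)
  then have "(s, t) \<in> triangles a b d" using s(1) by (simp add: triangles_def)
  then show "triangles a b d \<noteq> {}" by blast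
qed

lemma compact_triangles: "compact (triangles a b d)"
proof -
  have "closed {x :: complex \<times> complex. of_real a * fst x + of_real b * snd x = of_real d}"
    by (intro closed_Collect_eq continuous_intros)
  then have "compact ((sphere 0 1 \<times> sphere 0 1) \<inter>
      {x :: complex \<times> complex. of_real a * fst x + of_real b * snd x = of_real d})"
    by (intro compact_Int_closed compact_Times compact_sphere)
  also have "(sphere 0 1 \<times> sphere 0 1) \<inter>
      {x :: complex \<times> complex. of_real a * fst x + of_real b * snd x = of_real d} = triangles a b d"
    by (auto simp: triangles_def)
  finally show ?thesis .
qed

text \<open>
  If \<open>a\<close> and \<open>d\<close> are nonzero, then the law of cosines determines the direction of \<open>a\<close> up to
  conjugation. Otherwise it is arbitrary, if there is a triangle at all. In both cases it determines the direction of \<open>b\<close>, except that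
  an edge of length zero may point anywhere.
\<close>
lemma connected_modulo_triangles:
  "connected_modulo {map_prod cnj cnj} (triangles a b d)"
proof (rule connected_modulo_fibration[where f = fst and H = "{cnj}" and F = "{}"])
  show "compact (triangles a b d)" by (rule compact_triangles)
  show "continuous_on (triangles a b d) fst" by (intro continuous_intros)
next
  let ?B = "fst ` triangles a b d"
  have nb: "norm s = 1 \<and> norm (of_real d - of_real a * s) = \<bar>b\<bar>" if s: "s \<in> ?B" for s
  proof -
    obtain t where "(s, t) \<in> triangles a b d" using s by auto
    then have "norm s = 1" "norm t = 1" "of_real a * s + of_real b * t = of_real d"
      by (simp_all add: triangles_def)
    moreover from this have "of_real d - of_real a * s = of_real b * t" by (simp add: algebra_simps)
    ultimately show ?thesis by (simp add: norm_mult)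
  qed
  show "connected_modulo {cnj} ?B"
  proof (cases "a * d = 0")
    case True
    have "?B = sphere 0 1" if ne: "?B \<noteq> {}"
    proof -
      obtain s where "s \<in> ?B" using ne by blast
      from nb[OF this] have s: "norm s = 1" "norm (of_real d - of_real a * s) = \<bar>b\<bar>" by auto
      have "s' \<in> ?B" if s': "norm s' = 1" for s'
      proof -
        have b: "norm (of_real d - of_real a * s') = \<bar>b\<bar>"
          using True s s' by (auto simp: norm_mult)
        define t where "t = (if b = 0 then 1 else (of_real d - of_real a * s') / of_real b)"
        have "norm t = 1" "of_real b * t = of_real d - of_real a * s'"
          using b by (auto simp: t_def norm_divide)
        then have "(s', t) \<in> triangles a b d" using s' by (simp add: triangles_def)
        then show ?thesis by (rule image_eqI[rotated]) simp
      qed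
      then have "sphere 0 1 \<subseteq> ?B" by (simp add: subset_iff)
      moreover have "?B \<subseteq> sphere 0 1" using nb by (intro subsetI) simp
      ultimately show ?thesis by (rule equalityI[rotated])
    qed
    then have "connected ?B"
      using connected_circle connected_empty by metis
    moreover have "closed ?B"
      using compact_continuous_image[OF continuous_on_fst[OF continuous_on_id] compact_triangles]
      by (rule compact_imp_closed)
    ultimately show ?thesis by (rule connected_imp_connected_modulo)
  next
    case False
    have two: "s' = s \<or> s' = cnj s" if "s \<in> ?B" "s' \<in> ?B" for s s'
    proof -
      have sq: "(Re x)\<^sup>2 + (Im x)\<^sup>2 = 1 \<and> d\<^sup>2 - 2 * a * d * Re x + a\<^sup>2 = b\<^sup>2" if "x \<in> ?B" for x
      proof -
        have 1: "(Re x)\<^sup>2 + (Im x)\<^sup>2 = 1" using nb[OF that] cmod_power2[of x] by simp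
        have "(norm (of_real d - of_real a * x))\<^sup>2 = b\<^sup>2" using nb[OF that] by simp
        then have 2: "(d - a * Re x)\<^sup>2 + (a * Im x)\<^sup>2 = b\<^sup>2" by (simp add: cmod_power2)
        have "(d - a * Re x)\<^sup>2 + (a * Im x)\<^sup>2 = d\<^sup>2 - 2 * a * d * Re x + a\<^sup>2 * ((Re x)\<^sup>2 + (Im x)\<^sup>2)"
          by (simp add: power2_eq_square algebra_simps)
        then show ?thesis using 1 2 by simp
      qed
      have "(a * d) * Re s = (a * d) * Re s'"
        using sq[OF that(1)] sq[OF that(2)] by (simp add: algebra_simps)
      then have re: "Re s = Re s'" using False by simp
      then have "(Im s)\<^sup>2 = (Im s')\<^sup>2" using sq[OF that(1)] sq[OF that(2)] by simp
      then show ?thesis using re by (auto simp: power2_eq_iff complex_eq_iff)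
    qed
    show ?thesis
    proof (rule connected_moduloI)
      fix U V
      assume UV: "U \<union> V = ?B" "U \<inter> V = {}"
        and U: "\<And>g x. g \<in> {cnj} \<Longrightarrow> x \<in> U \<Longrightarrow> g x \<in> U"
      show "U = {} \<or> V = {}"
      proof (rule ccontr)
        assume "\<not> (U = {} \<or> V = {})"
        then obtain s s' where "s \<in> U" "s' \<in> V" by blast
        moreover have "cnj s \<in> U" using U[of cnj s] \<open>s \<in> U\<close> by simp
        ultimately show False using two[of s s'] UV by blast
      qed
    qed
  qed
next
  fix h assume "h \<in> {cnj}"
  then show "\<exists>g\<in>{map_prod cnj cnj}. \<forall>x\<in>triangles a b d. fst (g x) = h (fst x)" by auto
next
  fix s
  let ?F = "{x \<in> triangles a b d. fst x = s}"
  assume "s \<in> fst ` triangles a b d"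
  then have "norm s = 1" by (auto simp: triangles_def)
  then have F: "?F = {s} \<times> {t. norm t = 1 \<and> of_real b * t = of_real d - of_real a * s}"
    by (auto simp: triangles_def algebra_simps)
  have "connected ?F"
    unfolding F by (intro connected_Times connected_multiples connected_sing)
  moreover have "closed ?F"
  proof -
    have "?F = triangles a b d \<inter> fst -` {s}" by auto
    then show ?thesis
      using continuous_closed_preimage[OF continuous_on_fst[OF continuous_on_id]
          compact_imp_closed[OF compact_triangles] closed_singleton] by simp
  qed
  ultimately show "connected_modulo {} ?F" by (simp add: connected_modulo_empty_iff)
qed auto

text \<open>
  The polygon inequalities for the edges \<open>\<rho>\<close> and \<open>l\<close>, relaxed by \<open>c\<close>, let the chain end within distance
  \<open>c\<close> of \<open>\<rho>\<close>. The induction removes the longest edge \<open>m\<close>. The remaining gap \<open>\<rho>'\<close> may be any number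
  in \<open>{\<bar>\<rho> - l m\<bar>..\<rho> + l m}\<close>, and choosing it as large as the remaining edges permit keeps the polygon
  inequalities.
\<close>
lemma polygon_exists:
  assumes "finite J" "\<And>k. k \<in> J \<Longrightarrow> 0 \<le> l k" "0 \<le> \<rho>" "0 \<le> c"
    and "\<rho> \<le> c + sum l J"
    and "\<And>k. k \<in> J \<Longrightarrow> 2 * l k \<le> c + \<rho> + sum l J"
  shows "\<exists>u\<in>torus. norm (of_real \<rho> - (\<Sum>k\<in>J. of_real (l k) * u k)) \<le> c"
  using assms
proof (induction "card J" arbitrary: J \<rho>)
  case 0
  then show ?case by (intro bexI[of _ "\<lambda>_. 1"]) (auto simp: torus_def)
next
  case (Suc n)
  then have "J \<noteq> {}" by auto
  have "Max (l ` J) \<in> l ` J" using Suc.prems(1) \<open>J \<noteq> {}\<close> by simp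
  then obtain m where m: "m \<in> J" "l m = Max (l ` J)" by auto
  then have mx: "l k \<le> l m" if "k \<in> J" for k
    using that Suc.prems(1) by simp
  define J' where "J' = J - {m}"
  have J': "finite J'" "card J' = n" "m \<notin> J'" "J = insert m J'"
    using Suc m by (auto simp: J'_def)
  have sumJ: "sum l J = l m + sum l J'" using J' by simp
  define \<rho>' where "\<rho>' = min (\<rho> + l m) (c + sum l J')"
  have nonneg: "0 \<le> l m" "0 \<le> sum l J'" using Suc.prems(2) m J' by (auto intro: sum_nonneg)
  have le: "\<bar>\<rho> - l m\<bar> \<le> \<rho>'" "\<rho>' \<le> \<rho> + l m"
    using Suc.prems(3,4,5) Suc.prems(6)[OF m(1)] nonneg by (auto simp: \<rho>'_def sumJ)
  obtain t :: complex where t: "norm t = 1" "norm (of_real \<rho> - of_real (l m) * t) = \<rho>'"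
    using circle_distance_surj[OF le] by blast
  have "\<exists>u\<in>torus. norm (of_real \<rho>' - (\<Sum>k\<in>J'. of_real (l k) * u k)) \<le> c"
  proof (rule Suc.hyps(1))
    show "\<rho>' \<le> c + sum l J'" by (simp add: \<rho>'_def)
    show "0 \<le> \<rho>'" using le by simp
  next
    fix k assume k: "k \<in> J'"
    then show "0 \<le> l k" using Suc.prems(2) J' by simp
    have "l k \<le> sum l J'"
      by (rule member_le_sum[OF k _ J'(1)]) (use Suc.prems(2) J' in auto)
    then show "2 * l k \<le> c + \<rho>' + sum l J'"
      using mx[of k] k J' Suc.prems(3,4) by (auto simp: \<rho>'_def)
  qed (use J' Suc.prems in auto)
  then obtain u where u: "u \<in> torus" "norm (of_real \<rho>' - (\<Sum>k\<in>J'. of_real (l k) * u k)) \<le> c"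
    by blast
  \<comment> \<open>The chain for \<open>\<rho>'\<close> is rotated into the direction of the gap that the edge \<open>m\<close> leaves open.\<close>
  define e where "e = (if \<rho>' = 0 then 1 else (of_real \<rho> - of_real (l m) * t) / of_real \<rho>')"
  have e: "norm e = 1" "of_real \<rho> - of_real (l m) * t = of_real \<rho>' * e"
    using t le by (auto simp: e_def norm_divide)
  define w where "w = (\<lambda>k. if k = m then t else e * u k)"
  have "(\<Sum>k\<in>J'. of_real (l k) * w k) = e * (\<Sum>k\<in>J'. of_real (l k) * u k)"
    unfolding sum_distrib_left by (rule sum.cong) (use J' in \<open>auto simp: w_def\<close>)
  then have "of_real \<rho> - (\<Sum>k\<in>J. of_real (l k) * w k) =
      e * (of_real \<rho>' - (\<Sum>k\<in>J'. of_real (l k) * u k))"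
    using J' e(2) by (simp add: w_def algebra_simps)
  moreover have "w \<in> torus" using u e t by (auto simp: w_def torus_def norm_mult)
  ultimately show ?case using u(2) e(1) by (auto intro!: bexI[of _ w] simp: norm_mult)
qed

lemma connected_gap_lengths: "connected (gap_lengths J l \<rho>)"
  unfolding gap_lengths_def by (intro connected_continuous_image continuous_intros connected_torus)

section \<open>Cutting a polygon along a diagonal\<close>

type_synonym hinged = "(real \<times> complex \<times> complex) \<times> (nat \<Rightarrow> complex)"

text \<open>
  The polygons cut along the diagonal \<open>d\<close> that spans the edges \<open>a\<close> and \<open>q\<close>. The triangle is kept in the
  frame in which the diagonal is the segment from \<open>0\<close> to \<open>d\<close>, and the chain in which the diagonal serves
  as the edge \<open>q\<close> is kept in the frame of the whole polygon. In this form both pieces can be reflected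
  independently, also at \<open>d = 0\<close>, where the direction of the diagonal is not determined by the polygon.
\<close>
definition hinged_chains :: "nat \<Rightarrow> nat set \<Rightarrow> real \<Rightarrow> (nat \<Rightarrow> real) \<Rightarrow> real \<Rightarrow> hinged set" where
  "hinged_chains q J a l \<rho> =
     {((d, st), u). 0 \<le> d \<and> st \<in> triangles a (l q) d \<and> u \<in> chain_space (insert q J) (l(q := d)) (of_real \<rho>)}"

definition flip_triangle :: "hinged \<Rightarrow> hinged" where
  "flip_triangle = (\<lambda>((d, s, t), u). ((d, cnj s, cnj t), u))"

definition flip_chain :: "hinged \<Rightarrow> hinged" where
  "flip_chain = (\<lambda>((d, st), u). ((d, st), cnj_dirs u))"

text \<open>
  Rotating the triangle by the direction \<open>u q\<close> of the diagonal reassembles the polygon.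
\<close>
definition unfold_hinge :: "nat \<Rightarrow> nat \<Rightarrow> hinged \<Rightarrow> nat \<Rightarrow> complex" where
  "unfold_hinge p q = (\<lambda>((d, s, t), u). u(p := s * u q, q := t * u q))"

lemma cnj_dirs_invol [simp]: "cnj_dirs (cnj_dirs u) = u"
  by (simp add: cnj_dirs_def)

lemma cnj_dirs_chains:
  assumes "u \<in> chain_space J l (of_real \<rho>)" shows "cnj_dirs u \<in> chain_space J l (of_real \<rho>)"
proof -
  have u: "u \<in> torus" "(\<Sum>k\<in>J. of_real (l k) * u k) = of_real \<rho>"
    using assms by (simp_all add: chain_space_def)
  show ?thesis using arg_cong[OF u(2), of cnj] u(1) by (simp add: chain_space_def torus_def cnj_dirs_def)
qed

lemma cnj_triangles:
  assumes "(s, t) \<in> triangles a b d" shows "(cnj s, cnj t) \<in> triangles a b d"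
proof -
  have st: "norm s = 1" "norm t = 1" "of_real a * s + of_real b * t = of_real d"
    using assms by (simp_all add: triangles_def)
  show ?thesis using arg_cong[OF st(3), of cnj] st(1,2) by (simp add: triangles_def)
qed

lemma flip_triangle_simp [simp]: "flip_triangle ((d, s, t), u) = ((d, cnj s, cnj t), u)"
  by (simp add: flip_triangle_def)

lemma flip_chain_simp [simp]: "flip_chain ((d, st), u) = ((d, st), cnj_dirs u)"
  by (simp add: flip_chain_def)

lemma flip_triangle_hinged: "x \<in> hinged_chains q J a l \<rho> \<Longrightarrow> flip_triangle x \<in> hinged_chains q J a l \<rho>"
  by (cases x) (auto simp: hinged_chains_def cnj_triangles)

lemma flip_chain_hinged: "x \<in> hinged_chains q J a l \<rho> \<Longrightarrow> flip_chain x \<in> hinged_chains q J a l \<rho>"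
  by (cases x) (auto simp: hinged_chains_def cnj_dirs_chains)

lemma flip_invol [simp]:
  "flip_triangle (flip_triangle x) = x" "flip_chain (flip_chain x) = x"
  "flip_triangle (flip_chain x) = flip_chain (flip_triangle x)"
  by (simp_all add: flip_triangle_def flip_chain_def case_prod_unfold)

lemma continuous_on_cnj_dirs:
  "continuous_on S f \<Longrightarrow> continuous_on S (\<lambda>x. cnj_dirs (f x))"
  unfolding cnj_dirs_def
  by (rule continuous_on_coordinatewise_then_product, rule continuous_on_cnj,
      erule continuous_on_coordinate)

lemma continuous_on_flips:
  "continuous_on S flip_triangle" "continuous_on S flip_chain"
  unfolding flip_triangle_def flip_chain_def case_prod_unfold
  by (intro continuous_on_Pair continuous_on_cnj continuous_on_cnj_dirs continuous_on_fst
      continuous_on_snd continuous_on_id)+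

lemma chains_insert_iff:
  assumes "finite J" "q \<notin> J"
  shows "u \<in> chain_space (insert q J) (l(q := d)) z \<longleftrightarrow>
    u \<in> torus \<and> of_real d * u q + (\<Sum>k\<in>J. of_real (l k) * u k) = z"
proof -
  have "(\<Sum>k\<in>J. of_real ((l(q := d)) k) * u k) = (\<Sum>k\<in>J. of_real (l k) * u k)"
    by (rule sum.cong) (use assms in auto)
  then show ?thesis using assms by (simp add: chain_space_def)
qed

lemma compact_hinged_chains:
  assumes "finite J" "q \<notin> J" "0 \<le> a" "0 \<le> l q"
  shows "compact (hinged_chains q J a l \<rho>)"
proof -
  let ?box = "({0..a + l q} \<times> sphere 0 1 \<times> sphere 0 1) \<times> torus :: hinged set"
  let ?E = "{x :: hinged. of_real a * fst (snd (fst x)) + of_real (l q) * snd (snd (fst x)) = of_real (fst (fst x))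
      \<and> of_real (fst (fst x)) * snd x q + (\<Sum>k\<in>J. of_real (l k) * snd x k) = of_real \<rho>}"
  have "closed ?E"
    by (intro closed_Collect_conj closed_Collect_eq continuous_intros)
  then have "compact (?box \<inter> ?E)"
    by (intro compact_Int_closed compact_Times compact_sphere compact_torus compact_Icc)
  also have "?box \<inter> ?E = hinged_chains q J a l \<rho>"
  proof -
    have "d \<le> a + l q" if "0 \<le> d" "(s, t) \<in> triangles a (l q) d" for d s t
      using triangles_nonempty_iff[OF assms(3,4) that(1)] that(2) by auto
    then show ?thesis
      by (auto simp: hinged_chains_def chains_insert_iff[OF assms(1,2)] triangles_def)
  qed
  finally show ?thesis .
qed

lemma chains_nonempty_iff_gap_length:
  assumes J: "finite J" "q \<notin> J" and d: "0 \<le> d"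
  shows "chain_space (insert q J) (l(q := d)) (of_real \<rho>) \<noteq> {} \<longleftrightarrow> d \<in> gap_lengths J l \<rho>"
proof
  assume "chain_space (insert q J) (l(q := d)) (of_real \<rho>) \<noteq> {}"
  then obtain u where "u \<in> chain_space (insert q J) (l(q := d)) (of_real \<rho>)" by blast
  then have u: "u \<in> torus" "of_real d * u q + (\<Sum>k\<in>J. of_real (l k) * u k) = of_real \<rho>"
    using chains_insert_iff[OF J] by auto
  then have "of_real \<rho> - (\<Sum>k\<in>J. of_real (l k) * u k) = of_real d * u q" by (simp add: algebra_simps)
  then have "norm (of_real \<rho> - (\<Sum>k\<in>J. of_real (l k) * u k)) = d"
    using u(1) d by (simp add: norm_mult torus_def)
  then show "d \<in> gap_lengths J l \<rho>" unfolding gap_lengths_def using u(1) by (intro image_eqI[of _ _ u]) simp_all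
next
  assume "d \<in> gap_lengths J l \<rho>"
  then obtain u where u: "u \<in> torus" "norm (of_real \<rho> - (\<Sum>k\<in>J. of_real (l k) * u k)) = d"
    by (auto simp: gap_lengths_def)
  define e where "e = (if d = 0 then 1 else (of_real \<rho> - (\<Sum>k\<in>J. of_real (l k) * u k)) / of_real d)"
  have e: "norm e = 1" "of_real d * e = of_real \<rho> - (\<Sum>k\<in>J. of_real (l k) * u k)"
    using u(2) d by (auto simp: e_def norm_divide)
  have "(\<Sum>k\<in>J. of_real (l k) * (u(q := e)) k) = (\<Sum>k\<in>J. of_real (l k) * u k)"
    by (rule sum.cong) (use J in auto)
  then have "u(q := e) \<in> chain_space (insert q J) (l(q := d)) (of_real \<rho>)"
    using u(1) e unfolding chains_insert_iff[OF J] by (simp add: torus_def)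
  then show "chain_space (insert q J) (l(q := d)) (of_real \<rho>) \<noteq> {}" by blast
qed

text \<open>
  The triangle inequality and the remaining chain constrain the diagonal independently, and each of the two
  conditions describes an interval.
\<close>
lemma hinged_lengths:
  assumes J: "finite J" "q \<notin> J" and nn: "0 \<le> a" "0 \<le> l q"
  shows "(fst \<circ> fst) ` hinged_chains q J a l \<rho> = gap_lengths J l \<rho> \<inter> {\<bar>a - l q\<bar>..a + l q}" (is "?L = ?R")
proof (rule set_eqI)
  fix d
  have "d \<in> ?L \<longleftrightarrow> 0 \<le> d \<and> triangles a (l q) d \<noteq> {} \<and> chain_space (insert q J) (l(q := d)) (of_real \<rho>) \<noteq> {}"
    by (force simp: hinged_chains_def image_iff)
  also have "\<dots> \<longleftrightarrow> 0 \<le> d \<and> \<bar>a - l q\<bar> \<le> d \<and> d \<le> a + l q \<and> d \<in> gap_lengths J l \<rho>"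
    using triangles_nonempty_iff[OF nn] chains_nonempty_iff_gap_length[OF J] by metis
  also have "\<dots> \<longleftrightarrow> d \<in> ?R" by auto
  finally show "d \<in> ?L \<longleftrightarrow> d \<in> ?R" .
qed

text \<open>
  The pieces are fibred over the triangles, the triangles over the interval of possible diagonals.
  Each of the two projections contributes one reflection.
\<close>
lemma connected_modulo_hinged_chains:
  assumes J: "finite J" "q \<notin> J" and nn: "0 \<le> a" "0 \<le> l q"
    and mod: "\<And>d. 0 \<le> d \<Longrightarrow>
      connected_modulo {cnj_dirs} (chain_space (insert q J) (l(q := d)) (of_real \<rho>))"
  shows "connected_modulo {flip_triangle, flip_chain} (hinged_chains q J a l \<rho>)"
proof (rule connected_modulo_fibration[where f = fst and F = "{flip_chain}"
      and H = "{\<lambda>(d, s, t). (d, cnj s, cnj t)}"])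
  let ?K = "hinged_chains q J a l \<rho>"
  show K: "compact ?K" by (rule compact_hinged_chains[of J q a l, OF J nn])
  show "continuous_on ?K fst" by (intro continuous_intros)
  have "compact (fst ` ?K)"
    by (intro compact_continuous_image continuous_intros K)
  then show "connected_modulo {\<lambda>(d, s, t). (d, cnj s, cnj t)} (fst ` ?K)"
  proof (rule connected_modulo_fibration[where f = fst and F = "{\<lambda>(d, s, t). (d, cnj s, cnj t)}" and H = "{}"])
    show "continuous_on (fst ` ?K) fst" by (intro continuous_intros)
    have "connected (gap_lengths J l \<rho> \<inter> {\<bar>a - l q\<bar>..a + l q})"
      using connected_gap_lengths[of J l \<rho>] unfolding is_interval_connected_1[symmetric]
      by (intro is_interval_Int is_interval_cc)
    moreover have "closed (fst ` fst ` ?K)"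
      by (intro compact_imp_closed compact_continuous_image continuous_intros K)
    moreover have "fst ` fst ` ?K = gap_lengths J l \<rho> \<inter> {\<bar>a - l q\<bar>..a + l q}"
      using hinged_lengths[of J q a l, OF J nn] by (simp add: image_comp)
    ultimately show "connected_modulo {} (fst ` fst ` ?K)"
      by (simp add: connected_modulo_empty_iff)
  next
    fix d assume d: "d \<in> fst ` fst ` ?K"
    have "{x \<in> fst ` ?K. fst x = d} = Pair d ` triangles a (l q) d"
      using d by (force simp: hinged_chains_def image_iff)
    moreover have "connected_modulo {\<lambda>(d, s, t). (d, cnj s, cnj t)} (Pair d ` triangles a (l q) d)"
    proof (rule connected_modulo_image[OF connected_modulo_triangles])
      show "closed (triangles a (l q) d)" by (rule compact_imp_closed[OF compact_triangles])
      show "continuous_on (triangles a (l q) d) (Pair d)" by (intro continuous_intros)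
    next
      fix g x assume "g \<in> {map_prod cnj cnj}" "x \<in> triangles a (l q) d"
      then show "g x \<in> triangles a (l q) d" by (cases x) (simp add: cnj_triangles)
    next
      fix g :: "complex \<times> complex \<Rightarrow> complex \<times> complex"
      assume "g \<in> {map_prod cnj cnj}"
      then show "\<exists>h\<in>{\<lambda>(d, s, t). (d, cnj s, cnj t)}. \<forall>x\<in>triangles a (l q) d. (d, g x) = h (d, x)"
        by auto
    qed
    ultimately show "connected_modulo {\<lambda>(d, s, t). (d, cnj s, cnj t)} {x \<in> fst ` ?K. fst x = d}"
      by simp
  qed auto
next
  fix h :: "real \<times> complex \<times> complex \<Rightarrow> real \<times> complex \<times> complex"
  assume "h \<in> {\<lambda>(d, s, t). (d, cnj s, cnj t)}"
  then show "\<exists>g\<in>{flip_triangle, flip_chain}. \<forall>x\<in>hinged_chains q J a l \<rho>. fst (g x) = h (fst x)"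
    by (auto simp: flip_triangle_def)
next
  fix c assume c: "c \<in> fst ` hinged_chains q J a l \<rho>"
  obtain d st where dst: "c = (d, st)" by (cases c)
  have d: "0 \<le> d" using c by (auto simp: dst hinged_chains_def)
  have "{x \<in> hinged_chains q J a l \<rho>. fst x = c} =
      Pair c ` chain_space (insert q J) (l(q := d)) (of_real \<rho>)"
    using c by (force simp: hinged_chains_def image_iff dst)
  moreover have "connected_modulo {flip_chain} (Pair c ` chain_space (insert q J) (l(q := d)) (of_real \<rho>))"
  proof (rule connected_modulo_image[OF mod[OF d]])
    show "closed (chain_space (insert q J) (l(q := d)) (of_real \<rho>))"
      by (rule compact_imp_closed[OF compact_chains])
    show "continuous_on (chain_space (insert q J) (l(q := d)) (of_real \<rho>)) (Pair c)"
      by (intro continuous_intros)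
  next
    fix g x assume "g \<in> {cnj_dirs}" "x \<in> chain_space (insert q J) (l(q := d)) (of_real \<rho>)"
    then show "g x \<in> chain_space (insert q J) (l(q := d)) (of_real \<rho>)" by (simp add: cnj_dirs_chains)
  next
    fix g assume "g \<in> {cnj_dirs}"
    then show "\<exists>h\<in>{flip_chain}. \<forall>x\<in>chain_space (insert q J) (l(q := d)) (of_real \<rho>). (c, g x) = h (c, x)"
      by (auto simp: dst)
  qed
  ultimately show "connected_modulo {flip_chain} {x \<in> hinged_chains q J a l \<rho>. fst x = c}"
    by simp
qed (auto simp: flip_chain_def)

lemma continuous_on_unfold_hinge: "continuous_on S (unfold_hinge p q)"
proof (rule continuous_on_coordinatewise_then_product)
  fix i
  consider "i = q" | "i = p" "i \<noteq> q" | "i \<noteq> p" "i \<noteq> q" by blast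
  then show "continuous_on S (\<lambda>x. unfold_hinge p q x i)"
    by cases (simp_all add: unfold_hinge_def case_prod_unfold, (intro continuous_intros)+)
qed

text \<open>
  Every polygon arises: its diagonal \<open>v\<close> has the direction \<open>v / \<bar>v\<bar>\<close>, and for \<open>v = 0\<close> any direction will do.
\<close>
lemma unfold_hinge_image:
  assumes J: "finite J" "q \<notin> J" "p \<notin> J" "p \<noteq> q"
  shows "unfold_hinge p q ` hinged_chains q J (l p) l \<rho> = chain_space (insert p (insert q J)) l (of_real \<rho>)"
proof (intro equalityI subsetI)
  fix w assume "w \<in> unfold_hinge p q ` hinged_chains q J (l p) l \<rho>"
  then obtain x where x: "w = unfold_hinge p q x" "x \<in> hinged_chains q J (l p) l \<rho>" by (rule imageE)
  obtain d s t u where xe: "x = ((d, s, t), u)" by (metis prod.collapse)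
  have st: "norm s = 1" "norm t = 1" "of_real (l p) * s + of_real (l q) * t = of_real d"
    and u: "u \<in> torus" "of_real d * u q + (\<Sum>k\<in>J. of_real (l k) * u k) = of_real \<rho>"
    using x(2) by (auto simp: xe hinged_chains_def triangles_def chains_insert_iff[OF J(1,2)])
  have w: "w = u(p := s * u q, q := t * u q)" by (simp add: x(1) xe unfold_hinge_def)
  have "(\<Sum>k\<in>J. of_real (l k) * w k) = (\<Sum>k\<in>J. of_real (l k) * u k)"
    by (rule sum.cong) (use J w in auto)
  then have "(\<Sum>k\<in>insert p (insert q J). of_real (l k) * w k) =
      (of_real (l p) * s + of_real (l q) * t) * u q + (\<Sum>k\<in>J. of_real (l k) * u k)"
    using J by (simp add: w algebra_simps)
  moreover have "w \<in> torus" using u(1) st by (simp add: w torus_def norm_mult)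
  ultimately show "w \<in> chain_space (insert p (insert q J)) l (of_real \<rho>)"
    using st(3) u(2) by (simp add: chain_space_def)
next
  fix w assume "w \<in> chain_space (insert p (insert q J)) l (of_real \<rho>)"
  then have w: "\<And>k. norm (w k) = 1"
      "of_real (l p) * w p + of_real (l q) * w q + (\<Sum>k\<in>J. of_real (l k) * w k) = of_real \<rho>"
    using J by (auto simp: chain_space_def torus_def add.assoc)
  define v where "v = of_real (l p) * w p + of_real (l q) * w q"
  define c where "c = (if v = 0 then 1 else v / of_real (norm v))"
  have c: "norm c = 1" "of_real (norm v) * c = v" by (auto simp: c_def norm_divide)
  have c0: "c \<noteq> 0" using c(1) by auto
  define u where "u = w(q := c)"
  have "(\<Sum>k\<in>J. of_real (l k) * u k) = (\<Sum>k\<in>J. of_real (l k) * w k)"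
    by (rule sum.cong) (use J u_def in auto)
  then have "u \<in> chain_space (insert q J) (l(q := norm v)) (of_real \<rho>)"
    unfolding chains_insert_iff[OF J(1,2)] using w c by (simp add: u_def torus_def v_def)
  moreover have "(w p / c, w q / c) \<in> triangles (l p) (l q) (norm v)"
    using w(1) c c0 by (simp add: triangles_def norm_divide v_def divide_simps)
  ultimately have "((norm v, w p / c, w q / c), u) \<in> hinged_chains q J (l p) l \<rho>"
    by (simp add: hinged_chains_def)
  moreover have "unfold_hinge p q ((norm v, w p / c, w q / c), u) = w"
    using J(4) c0 by (auto simp: unfold_hinge_def u_def)
  ultimately show "w \<in> unfold_hinge p q ` hinged_chains q J (l p) l \<rho>"
    by (metis imageI)
qed

lemma unfold_hinge_flip:
  "unfold_hinge p q (flip_chain (flip_triangle x)) = cnj_dirs (unfold_hinge p q x)"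
  by (cases x) (auto simp: unfold_hinge_def flip_triangle_def flip_chain_def cnj_dirs_def split: prod.splits)

section \<open>Connectedness of planar chain spaces\<close>

text \<open>
  Among any three of the edges \<open>\<rho>\<close> and \<open>l\<close> of the polygon, some two have total length at most half of the
  perimeter. Triples with and without \<open>\<rho>\<close> are listed separately because \<open>\<rho>\<close> is not
  indexed by \<open>J\<close>.
\<close>
definition no_long_triple :: "nat set \<Rightarrow> (nat \<Rightarrow> real) \<Rightarrow> real \<Rightarrow> bool" where
  "no_long_triple J l \<rho> \<longleftrightarrow>
     (let h = (\<rho> + sum l J) / 2 in
      \<forall>i\<in>J. \<forall>j\<in>J. i \<noteq> j \<longrightarrow>
        l i + l j \<le> h \<or>
        ((l i + \<rho> \<le> h \<or> l j + \<rho> \<le> h) \<and>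
         (\<forall>k\<in>J. k \<noteq> i \<longrightarrow> k \<noteq> j \<longrightarrow> l i + l k \<le> h \<or> l j + l k \<le> h)))"

lemma gap_length_bounds:
  assumes "\<And>k. k \<in> J \<Longrightarrow> 0 \<le> l k" "0 \<le> \<rho>" "d \<in> gap_lengths J l \<rho>"
  shows "d \<le> \<rho> + sum l J" "\<rho> - sum l J \<le> d"
proof -
  obtain u where u: "u \<in> torus" "d = norm (of_real \<rho> - (\<Sum>k\<in>J. of_real (l k) * u k))"
    using assms(3) by (auto simp: gap_lengths_def)
  have "norm (\<Sum>k\<in>J. of_real (l k) * u k) \<le> (\<Sum>k\<in>J. norm (of_real (l k) * u k))"
    by (rule norm_sum)
  also have "\<dots> = sum l J"
    by (rule sum.cong) (use u(1) assms(1) in \<open>auto simp: torus_def norm_mult\<close>)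
  finally have le: "norm (\<Sum>k\<in>J. of_real (l k) * u k) \<le> sum l J" .
  show "d \<le> \<rho> + sum l J"
    using norm_triangle_ineq4[of "of_real \<rho>" "\<Sum>k\<in>J. of_real (l k) * u k"] le assms(2)
    by (simp add: u(2))
  show "\<rho> - sum l J \<le> d"
    using norm_triangle_ineq2[of "of_real \<rho>" "\<Sum>k\<in>J. of_real (l k) * u k"] le assms(2)
    by (simp add: u(2))
qed

text \<open>
  If all edges in \<open>J\<close> point in the direction \<open>c = 1\<close> or all in the direction \<open>c = -1\<close>, and the diagonal in
  direction \<open>1\<close>, then the chain lies on the real axis and is its own reflection.
\<close>
lemma straight_hinged:
  assumes J: "finite J" "q \<notin> J" and nn: "0 \<le> a" "0 \<le> l q"
    and d: "\<bar>a - l q\<bar> \<le> d" "d \<le> a + l q"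
    and c: "\<bar>c\<bar> = 1" "d + c * sum l J = \<rho>"
  shows "\<exists>x\<in>hinged_chains q J a l \<rho>. flip_chain x = x"
proof -
  define u :: "nat \<Rightarrow> complex" where "u = (\<lambda>k. if k = q then 1 else of_real c)"
  have "0 \<le> d" using d by linarith
  have "triangles a (l q) d \<noteq> {}" using triangles_nonempty_iff[OF nn \<open>0 \<le> d\<close>] d by simp
  then obtain st where st: "st \<in> triangles a (l q) d" by blast
  have "(\<Sum>k\<in>J. of_real (l k) * u k) = (\<Sum>k\<in>J. of_real (c * l k))"
    by (rule sum.cong) (use J in \<open>auto simp: u_def\<close>)
  also have "\<dots> = of_real (c * sum l J)" by (simp add: sum_distrib_left)
  finally have "of_real d * u q + (\<Sum>k\<in>J. of_real (l k) * u k) = of_real \<rho>"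
    using c(2) by (simp add: u_def flip: of_real_add of_real_mult)
  moreover have "u \<in> torus" using c(1) by (simp add: u_def torus_def)
  ultimately have "((d, st), u) \<in> hinged_chains q J a l \<rho>"
    using st \<open>0 \<le> d\<close> by (simp add: hinged_chains_def chains_insert_iff[OF J])
  moreover have "cnj_dirs u = u" by (auto simp: cnj_dirs_def u_def)
  ultimately show ?thesis by (intro bexI[of _ "((d, st), u)"]) simp_all
qed

text \<open>
  For \<open>d = a + l q\<close> (\<open>c = 1\<close>) and for \<open>d = a - l q\<close> (\<open>c = -1\<close>) the triangle is flat and its own
  reflection.
\<close>
lemma folded_hinged:
  assumes J: "finite J" "q \<notin> J" and c: "\<bar>c\<bar> = 1" "a + c * l q = d" "0 \<le> d"
    and d: "d \<in> gap_lengths J l \<rho>"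
  obtains u where "((d, 1, of_real c), u) \<in> hinged_chains q J a l \<rho>"
    "flip_triangle ((d, 1, of_real c), u) = ((d, 1, of_real c), u)"
proof -
  obtain u where "u \<in> chain_space (insert q J) (l(q := d)) (of_real \<rho>)"
    using chains_nonempty_iff_gap_length[of J q, OF J c(3)] d by blast
  moreover have "(1, of_real c) \<in> triangles a (l q) d"
    using c by (auto simp: triangles_def)
  ultimately have "((d, 1, of_real c), u) \<in> hinged_chains q J a l \<rho>"
    using c(3) by (simp add: hinged_chains_def)
  then show ?thesis by (rule that) simp
qed

lemma diagonal_exists:
  assumes J: "finite J" "q \<notin> J" and nn: "0 \<le> a" "0 \<le> l q"
    and ne: "hinged_chains q J a l \<rho> \<noteq> {}"
  obtains d where "d \<in> gap_lengths J l \<rho>" "\<bar>a - l q\<bar> \<le> d" "d \<le> a + l q"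
proof -
  have "(fst \<circ> fst) ` hinged_chains q J a l \<rho> \<noteq> {}" using ne by simp
  then show ?thesis using that unfolding hinged_lengths[of J q a l, OF J nn] by auto
qed

text \<open>
  The largest gap the chain \<open>J\<close> can leave open is \<open>\<rho> + sum l J\<close>, attained when all its edges point away
  from \<open>\<rho>\<close>. So the longest diagonal either flattens the triangle or stretches the chain.
\<close>
lemma longest_diagonal:
  assumes J: "finite J" "q \<notin> J" and nn: "0 \<le> a" "0 \<le> l q" "\<And>k. k \<in> J \<Longrightarrow> 0 \<le> l k" "0 \<le> \<rho>"
    and ne: "hinged_chains q J a l \<rho> \<noteq> {}"
  shows "if a + l q \<le> \<rho> + sum l J
    then a + l q \<in> gap_lengths J l \<rho>
    else \<bar>a - l q\<bar> \<le> \<rho> + sum l J"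
proof -
  obtain d0 where d0: "d0 \<in> gap_lengths J l \<rho>" "\<bar>a - l q\<bar> \<le> d0" "d0 \<le> a + l q"
    by (rule diagonal_exists[OF J nn(1,2) ne])
  have M: "\<rho> + sum l J \<in> gap_lengths J l \<rho>"
  proof -
    have "of_real \<rho> - (\<Sum>k\<in>J. of_real (l k) * (- 1)) = complex_of_real (\<rho> + sum l J)"
      by (simp add: sum_negf)
    then have "norm (of_real \<rho> - (\<Sum>k\<in>J. complex_of_real (l k) * (- 1))) = \<rho> + sum l J"
      using nn(3,4) sum_nonneg[of J l] by (simp only: norm_of_real) simp
    then show ?thesis
      unfolding gap_lengths_def by (intro image_eqI[of _ _ "\<lambda>_. -1"]) (simp_all add: torus_def)
  qed
  have "d0 \<le> \<rho> + sum l J" by (rule gap_length_bounds[OF nn(3,4) d0(1)])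
  moreover have "{d0..\<rho> + sum l J} \<subseteq> gap_lengths J l \<rho>"
    by (rule connected_contains_Icc[OF connected_gap_lengths d0(1) M])
  ultimately show ?thesis using d0 by auto
qed

lemma split_two_longest:
  fixes l :: "nat \<Rightarrow> real"
  assumes "finite J" "2 \<le> card J"
  obtains p q J' where "J = insert p (insert q J')" "p \<noteq> q" "p \<notin> J'" "q \<notin> J'"
    "finite J'" "card J = Suc (Suc (card J'))" "l q \<le> l p" "\<forall>k\<in>J'. l k \<le> l q"
proof -
  have mx: "\<exists>m\<in>A. \<forall>k\<in>A. l k \<le> l m" if A: "finite A" "A \<noteq> {}" for A
  proof -
    have "Max (l ` A) \<in> l ` A" using A by simp
    then obtain m where "m \<in> A" "l m = Max (l ` A)" by auto
    then show ?thesis using A(1) by (intro bexI[of _ m] ballI) simp_all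
  qed
  have "J \<noteq> {}" using assms by auto
  from mx[OF assms(1) this] obtain p where p: "p \<in> J" "\<forall>k\<in>J. l k \<le> l p" by blast
  have "card (J - {p}) = card J - 1" using p(1) assms(1) by simp
  then have "J - {p} \<noteq> {}" using assms(2) by (metis card.empty diff_is_0_eq not_less_eq_eq numeral_2_eq_2 One_nat_def)
  moreover have "finite (J - {p})" using assms(1) by simp
  ultimately obtain q where q: "q \<in> J - {p}" "\<forall>k\<in>J - {p}. l k \<le> l q" using mx[of "J - {p}"] by blast
  have J: "J = insert p (insert q (J - {p, q}))" using p(1) q(1) by auto
  show ?thesis
  proof (rule that[OF J])
    show "card J = Suc (Suc (card (J - {p, q})))"
      by (subst J) (use p(1) q(1) assms(1) in simp)
  qed (use p q assms(1) in auto)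
qed

text \<open>
  Reflecting a polygon means reflecting both pieces. By induction there is no nontrivial clopen set
  invariant under the two separate reflections. The piece that is straight at the longest diagonal
  absorbs its own reflection, so that only the simultaneous reflection remains.
\<close>
lemma connected_modulo_chains:
  assumes "finite J" "\<And>k. k \<in> J \<Longrightarrow> 0 \<le> l k" "0 \<le> \<rho>"
  shows "connected_modulo {cnj_dirs} (chain_space J l (of_real \<rho>))"
  using assms
proof (induction "card J" arbitrary: J l rule: less_induct)
  case less
  show ?case
  proof (cases "card J \<le> 1")
    case True
    then show ?thesis
      by (intro connected_imp_connected_modulo connected_chains_le_1 less.prems
          compact_imp_closed compact_chains)
  next
    case False
    then have "2 \<le> card J" by simp
    then obtain p q J' where J: "J = insert p (insert q J')" "p \<noteq> q" "p \<notin> J'" "q \<notin> J'"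
      "finite J'" "card J = Suc (Suc (card J'))"
      by (rule split_two_longest[OF less.prems(1), where l = l])
    have nn: "0 \<le> l p" "0 \<le> l q" "\<And>k. k \<in> J' \<Longrightarrow> 0 \<le> l k" using less.prems(2) J(1) by auto
    let ?K = "hinged_chains q J' (l p) l \<rho>"
    have K: "connected_modulo {flip_triangle, flip_chain} ?K"
    proof (rule connected_modulo_hinged_chains[of J' q "l p" l \<rho>, OF J(5,4) nn(1,2)])
      fix d :: real assume "0 \<le> d"
      show "connected_modulo {cnj_dirs} (chain_space (insert q J') (l(q := d)) (of_real \<rho>))"
        by (rule less.hyps) (use J nn \<open>0 \<le> d\<close> less.prems(3) in auto)
    qed
    have cl: "closed ?K" by (intro compact_imp_closed compact_hinged_chains J(5,4) nn(1,2))
    have "connected_modulo {flip_triangle \<circ> flip_chain} ?K"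
    proof (cases "?K = {}")
      case True
      then show ?thesis by (simp add: connected_modulo_def)
    next
      case ne: False
      let ?M = "\<rho> + sum l J'"
      note top = longest_diagonal[of J' q "l p" l \<rho>, OF J(5,4) nn less.prems(3) ne]
      consider x where "x \<in> ?K" "flip_triangle x = x" | x where "x \<in> ?K" "flip_chain x = x"
      proof (cases "l p + l q \<le> ?M")
        case True
        then have "l p + l q \<in> gap_lengths J' l \<rho>" using top by simp
        then obtain u where "((l p + l q, 1, of_real 1), u) \<in> ?K"
            "flip_triangle ((l p + l q, 1, of_real 1), u) = ((l p + l q, 1, of_real 1), u)"
          using folded_hinged[of J' q 1 "l p" l "l p + l q" \<rho>, OF J(5,4)] nn by auto
        then show ?thesis by (rule that(1))
      next
        case False
        then have "\<bar>l p - l q\<bar> \<le> ?M" "?M \<le> l p + l q" using top by simp_all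
        then show ?thesis
          using straight_hinged[of J' q "l p" l ?M "-1" \<rho>, OF J(5,4) nn(1,2)] that(2) by auto
      qed
      then show ?thesis
      proof cases
        case 1
        \<comment> \<open>The reflection of the chain is the product of the two maps.\<close>
        have "connected_modulo {flip_triangle, flip_triangle \<circ> flip_chain} ?K"
          by (rule connected_modulo_mono[OF K]) auto
        then show ?thesis
          by (rule connected_modulo_absorb[where C = "{x}"])
            (use cl 1 in \<open>auto simp: continuous_on_flips flip_triangle_hinged flip_chain_hinged\<close>)
      next
        case 2
        have "connected_modulo {flip_chain, flip_triangle \<circ> flip_chain} ?K"
          by (rule connected_modulo_mono[OF K]) auto
        then show ?thesis
          by (rule connected_modulo_absorb[where C = "{x}"])
            (use cl 2 in \<open>auto simp: continuous_on_flips flip_triangle_hinged flip_chain_hinged\<close>)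
      qed
    qed
    then have "connected_modulo {cnj_dirs} (unfold_hinge p q ` ?K)"
      by (rule connected_modulo_image)
        (simp_all add: cl continuous_on_unfold_hinge flip_triangle_hinged flip_chain_hinged unfold_hinge_flip)
    then show ?thesis using unfold_hinge_image[OF J(5,4,3,2)] J(1) by simp
  qed
qed

text \<open>
  Merging the two longest edges into one keeps the perimeter. The new edge is at least as long as the sum
  of any two others in \<open>J\<close>, so such a pair is short. A pair \<open>\<rho>\<close>, \<open>k\<close> is short because
  \<open>\<rho> + 2 * l k \<le> l p - l q + sum l J + 2 * l k \<le> l p + l q + sum l J\<close>.
\<close>
lemma no_long_triple_merge:
  assumes J: "finite J" "p \<notin> J" "q \<notin> J" "p \<noteq> q"
    and nn: "\<And>k. k \<in> J \<Longrightarrow> 0 \<le> l k" "0 \<le> \<rho>" "0 \<le> l q" and ord: "l q \<le> l p" "\<And>k. k \<in> J \<Longrightarrow> l k \<le> l q"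
    and short: "\<rho> - sum l J \<le> l p - l q"
  shows "no_long_triple (insert q J) (l(q := l p + l q)) \<rho>"
proof -
  let ?l = "l(q := l p + l q)"
  let ?h = "(\<rho> + sum ?l (insert q J)) / 2"
  have sumJ: "sum ?l J = sum l J"
    by (rule sum.cong) (use J in auto)
  then have h: "?h = (\<rho> + l p + l q + sum l J) / 2" using J by simp
  have two: "l i + l j \<le> sum l J" if "i \<in> J" "j \<in> J" "i \<noteq> j" for i j
  proof -
    have "sum l {i, j} \<le> sum l J"
      by (rule sum_mono2) (use that J nn in auto)
    then show ?thesis using that by simp
  qed
  have jj: "l i + l j \<le> ?h" if "i \<in> J" "j \<in> J" "i \<noteq> j" for i j
    using two[OF that] ord(2)[OF that(1)] ord(2)[OF that(2)] ord(1) nn(2) unfolding h by simp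
  have jr: "l j + \<rho> \<le> ?h" if "j \<in> J" for j
    using ord(2)[OF that] short unfolding h by simp
  have qs: "?l k = l k" if "k \<in> J" for k using that J by auto
  show ?thesis
    unfolding no_long_triple_def Let_def
  proof (intro ballI impI)
    fix i j assume i: "i \<in> insert q J" and j: "j \<in> insert q J" and ij: "i \<noteq> j"
    consider "i \<in> J" "j \<in> J" | "i = q" "j \<in> J" | "j = q" "i \<in> J" using i j ij by blast
    then show "?l i + ?l j \<le> ?h \<or> ((?l i + \<rho> \<le> ?h \<or> ?l j + \<rho> \<le> ?h) \<and>
        (\<forall>k\<in>insert q J. k \<noteq> i \<longrightarrow> k \<noteq> j \<longrightarrow> ?l i + ?l k \<le> ?h \<or> ?l j + ?l k \<le> ?h))"
    proof cases
      case 1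
      then show ?thesis using jj[OF 1 ij] qs by simp
    next
      case 2
      have "\<forall>k\<in>insert q J. k \<noteq> i \<longrightarrow> k \<noteq> j \<longrightarrow> ?l j + ?l k \<le> ?h"
        using 2 jj[OF 2(2)] qs by (metis insert_iff)
      moreover have "?l j + \<rho> \<le> ?h" using jr[OF 2(2)] qs[OF 2(2)] by simp
      ultimately show ?thesis by blast
    next
      case 3
      have "\<forall>k\<in>insert q J. k \<noteq> i \<longrightarrow> k \<noteq> j \<longrightarrow> ?l i + ?l k \<le> ?h"
        using 3 jj[OF 3(2)] qs by (metis insert_iff)
      moreover have "?l i + \<rho> \<le> ?h" using jr[OF 3(2)] qs[OF 3(2)] by simp
      ultimately show ?thesis by blast
    qed
  qed
qed

text \<open>
  By \<open>connected_modulo_absorb\<close> it is enough to find one point fixed by the reflection of the triangle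
  and one chain joined to its own reflection within the hinged chains.
\<close>
lemma connected_chains:
  assumes "finite J" "\<And>k. k \<in> J \<Longrightarrow> 0 \<le> l k" "0 \<le> \<rho>" "no_long_triple J l \<rho>"
  shows "connected (chain_space J l (of_real \<rho>))"
  using assms
proof (induction "card J" arbitrary: J l rule: less_induct)
  case less
  show ?case
  proof (cases "card J \<le> 1")
    case True
    then show ?thesis by (rule connected_chains_le_1[OF less.prems(1)])
  next
    case False
    then have "2 \<le> card J" by simp
    then obtain p q J' where J: "J = insert p (insert q J')" "p \<noteq> q" "p \<notin> J'" "q \<notin> J'"
      "finite J'" "card J = Suc (Suc (card J'))" and ord: "l q \<le> l p" "\<forall>k\<in>J'. l k \<le> l q"
      by (rule split_two_longest[OF less.prems(1), where l = l])
    have nn: "0 \<le> l p" "0 \<le> l q" "\<And>k. k \<in> J' \<Longrightarrow> 0 \<le> l k" using less.prems(2) J(1) by auto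
    let ?K = "hinged_chains q J' (l p) l \<rho>"
    have K: "connected_modulo {flip_triangle, flip_chain} ?K"
      by (rule connected_modulo_hinged_chains[of J' q "l p" l \<rho>, OF J(5,4) nn(1,2)], rule connected_modulo_chains)
        (use J(5) nn less.prems(3) in auto)
    have comp: "compact ?K" by (intro compact_hinged_chains J(5,4) nn(1,2))
    then have cl: "closed ?K" by (rule compact_imp_closed)
    have image: "chain_space J l (of_real \<rho>) = unfold_hinge p q ` ?K"
      using unfold_hinge_image[OF J(5,4,3,2)] J(1) by simp
    have conn: "connected (chain_space J l (of_real \<rho>))"
      if T: "x \<in> ?K" "flip_triangle x = x"
        and P: "connected C" "C \<subseteq> ?K" "y \<in> C" "flip_chain y \<in> C" for x y C
    proof -
      have "connected_modulo {flip_chain} ?K"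
        by (rule connected_modulo_absorb[OF K, where C = "{x}"])
          (use cl T in \<open>auto simp: continuous_on_flips flip_triangle_hinged flip_chain_hinged\<close>)
      then have "connected_modulo {} ?K"
        by (rule connected_modulo_absorb[where C = C])
          (use cl P in \<open>auto simp: continuous_on_flips flip_triangle_hinged flip_chain_hinged\<close>)
      then have "connected ?K" using cl by (simp add: connected_modulo_empty_iff)
      then show ?thesis
        unfolding image by (intro connected_continuous_image continuous_on_unfold_hinge)
    qed
    show ?thesis
    proof (cases "?K = {}")
      case True
      then show ?thesis by (simp add: image)
    next
      case ne: False
      let ?S = "sum l J'"
      obtain d0 where d0: "d0 \<in> gap_lengths J' l \<rho>" "\<bar>l p - l q\<bar> \<le> d0" "d0 \<le> l p + l q"
        by (rule diagonal_exists[OF J(5,4) nn(1,2) ne])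
      have d0': "\<rho> - ?S \<le> d0" by (rule gap_length_bounds(2)[OF nn(3) less.prems(3) d0(1)])
      note top = longest_diagonal[of J' q "l p" l \<rho>, OF J(5,4) nn less.prems(3) ne]
      show ?thesis
      proof (cases "l p + l q \<le> \<rho> + ?S")
        case True
        \<comment> \<open>The triangle is flat for the diagonal \<open>l p + l q\<close>.\<close>
        then have "l p + l q \<in> gap_lengths J' l \<rho>" using top by simp
        then obtain u where u: "((l p + l q, 1, of_real 1), u) \<in> ?K"
            "flip_triangle ((l p + l q, 1, of_real 1), u) = ((l p + l q, 1, of_real 1), u)"
          using folded_hinged[of J' q 1 "l p" l "l p + l q" \<rho>, OF J(5,4)] nn by auto
        show ?thesis
        proof (cases "l p - l q \<le> \<rho> - ?S")
          case True
          \<comment> \<open>The chain can be stretched towards \<open>\<rho>\<close>, leaving the diagonal \<open>\<rho> - ?S\<close>.\<close>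
          then obtain y where "y \<in> ?K" "flip_chain y = y"
            using straight_hinged[of J' q "l p" l "\<rho> - ?S" 1 \<rho>, OF J(5,4) nn(1,2)] d0 d0' ord(1) by auto
          then show ?thesis using conn[OF u, of "{y}" y] by simp
        next
          case False
          \<comment> \<open>The chain with the merged edge \<open>l p + l q\<close> is joined to its reflection while the triangle stays flat.\<close>
          let ?C = "chain_space (insert q J') (l(q := l p + l q)) (of_real \<rho>)"
          have "connected ?C"
          proof (rule less.hyps)
            show "no_long_triple (insert q J') (l(q := l p + l q)) \<rho>"
              by (rule no_long_triple_merge) (use J nn ord less.prems(3) False in auto)
          qed (use J nn less.prems(3) in auto)
          then have "connected (Pair (l p + l q, 1, of_real 1) ` ?C)"
            by (intro connected_continuous_image continuous_intros)
          moreover have "Pair (l p + l q, 1, of_real 1) ` ?C \<subseteq> ?K" "u \<in> ?C"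
            using u(1) by (auto simp: hinged_chains_def)
          moreover have "cnj_dirs u \<in> ?C" by (rule cnj_dirs_chains) fact
          ultimately show ?thesis
            by (intro conn[OF u, of "Pair (l p + l q, 1, of_real 1) ` ?C" "((l p + l q, 1, of_real 1), u)"]) auto
        qed
      next
        case False
        \<comment> \<open>The edges \<open>p\<close> and \<open>q\<close> together exceed half of the perimeter, so every triple with \<open>p\<close> and \<open>q\<close>
          owes its short pair to \<open>q\<close>. These inequalities say that the chain can end within distance
          \<open>l p - l q\<close> of \<open>\<rho>\<close>. Hence \<open>l p - l q\<close> is a possible diagonal, at which the triangle is flat,
          and the longest diagonal stretches the chain.\<close>
        let ?h = "(\<rho> + sum l J) / 2"
        have h: "?h = (\<rho> + l p + l q + ?S) / 2" using J by simp
        have "\<bar>l p - l q\<bar> \<le> \<rho> + ?S" using top False by simp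
        then obtain y where y: "y \<in> ?K" "flip_chain y = y"
          using straight_hinged[of J' q "l p" l "\<rho> + ?S" "-1" \<rho>, OF J(5,4) nn(1,2)] False by auto
        have "\<not> l p + l q \<le> ?h" using False unfolding h by simp
        then have or: "l p + \<rho> \<le> ?h \<or> l q + \<rho> \<le> ?h"
          and ok: "\<forall>k\<in>J. k \<noteq> p \<longrightarrow> k \<noteq> q \<longrightarrow> l p + l k \<le> ?h \<or> l q + l k \<le> ?h"
          using less.prems(4) J(1,2) unfolding no_long_triple_def Let_def by (meson insertCI)+
        have q\<rho>: "l q + \<rho> \<le> ?h" using or ord(1) by linarith
        have qk: "l q + l k \<le> ?h" if "k \<in> J'" for k
        proof -
          have "k \<in> J" "k \<noteq> p" "k \<noteq> q" using that J by auto
          then show ?thesis using ok ord(1) by force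
        qed
        have "\<exists>w\<in>torus. norm (of_real \<rho> - (\<Sum>k\<in>J'. of_real (l k) * w k)) \<le> l p - l q"
          by (rule polygon_exists[OF J(5) nn(3) less.prems(3)])
            (use q\<rho> qk ord in \<open>auto simp: h field_simps\<close>)
        then obtain c where c: "c \<in> gap_lengths J' l \<rho>" "c \<le> l p - l q" by (auto simp: gap_lengths_def)
        have "{c..d0} \<subseteq> gap_lengths J' l \<rho>"
          by (rule connected_contains_Icc[OF connected_gap_lengths c(1) d0(1)])
        then have "l p - l q \<in> gap_lengths J' l \<rho>" using c(2) d0(2) by auto
        then obtain u where u: "((l p - l q, 1, of_real (-1)), u) \<in> ?K"
            "flip_triangle ((l p - l q, 1, of_real (-1)), u) = ((l p - l q, 1, of_real (-1)), u)"
          using folded_hinged[of J' q "-1" "l p" l "l p - l q" \<rho>, OF J(5,4)] ord(1) by auto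
        show ?thesis using conn[OF u, of "{y}" y] y by simp
      qed
    qed
  qed
qed

section \<open>From directions to configurations\<close>

definition to_vec :: "complex \<Rightarrow> real^2" where
  "to_vec z = vector [Re z, Im z]"

definition of_vec :: "real^2 \<Rightarrow> complex" where
  "of_vec v = Complex (v $ 1) (v $ 2)"

lemma to_vec_of_vec [simp]: "to_vec (of_vec v) = v"
  by (simp add: to_vec_def of_vec_def vec_eq_iff forall_2)

lemma of_vec_diff: "of_vec (v - w) = of_vec v - of_vec w"
  by (simp add: of_vec_def complex_eq_iff)

lemma to_vec_diff: "to_vec (z - w) = to_vec z - to_vec w"
  and to_vec_0 [simp]: "to_vec 0 = 0"
  by (simp_all add: to_vec_def vec_eq_iff forall_2)

lemma norm_to_vec [simp]: "norm (to_vec z) = norm z"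
  by (simp add: to_vec_def norm_vec_def L2_set_def sum_2 cmod_def)

lemma norm_of_vec [simp]: "norm (of_vec v) = norm v"
  by (metis norm_to_vec to_vec_of_vec)

lemma to_vec_inj: "to_vec z = to_vec w \<Longrightarrow> z = w"
  by (metis eq_iff_diff_eq_0 norm_eq_zero norm_to_vec to_vec_diff)

lemma continuous_on_to_vec: "continuous_on S to_vec"
  unfolding continuous_on_iff dist_norm to_vec_diff[symmetric] norm_to_vec by blast

definition endpoint :: "real list \<Rightarrow> (nat \<Rightarrow> complex) \<Rightarrow> complex" where
  "endpoint d u = (\<Sum>k<length d. of_real (d ! k) * u k)"

definition place :: "real list \<Rightarrow> (nat \<Rightarrow> complex) \<Rightarrow> nat \<Rightarrow> real^2" where
  "place d u = restrict (\<lambda>i. to_vec (\<Sum>k<i. of_real (d ! k) * u k)) {0..length d}"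

lemma place_0 [simp]: "place d u 0 = 0"
  and place_end [simp]: "place d u (length d) = to_vec (endpoint d u)"
  by (simp_all add: place_def endpoint_def)

lemma place_configuration:
  assumes d: "free_linkage d" and u: "u \<in> torus"
  shows "place d u \<in> configurations d"
proof -
  have "dist (place d u i) (place d u (Suc i)) = d ! i" if i: "i < length d" for i
  proof -
    have "0 < d ! i" using d i by (simp add: free_linkage_def)
    then show ?thesis using i u
      by (simp add: place_def dist_norm to_vec_diff[symmetric] norm_mult torus_def)
  qed
  moreover have "place d u \<in> {0..length d} \<rightarrow>\<^sub>E UNIV" by (auto simp: place_def)
  ultimately show ?thesis unfolding configurations_def by blast
qed

text \<open>
  The directions are the normalised edge vectors, and the vertices are recovered from them by
  telescoping.
\<close>
lemma configuration_directions:
  assumes d: "free_linkage d" and x: "x \<in> configurations d"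
  obtains u where "u \<in> torus" "\<forall>i\<le>length d. x i = x 0 + place d u i"
proof -
  define u where "u k = (if k < length d then of_vec (x (Suc k) - x k) / of_real (d ! k) else 1)" for k
  have pos: "0 < d ! k" if "k < length d" for k
    using d that by (simp add: free_linkage_def)
  have dist: "norm (x (Suc k) - x k) = d ! k" if "k < length d" for k
    using x that by (simp add: configurations_def dist_norm norm_minus_commute)
  have "norm (u k) = 1" for k
    using pos[of k] dist[of k] by (cases "k < length d") (simp_all add: u_def norm_divide)
  then have "u \<in> torus" by (simp add: torus_def)
  moreover have "x i = x 0 + place d u i" if i: "i \<le> length d" for i
  proof -
    have "(\<Sum>k<i. of_real (d ! k) * u k) = (\<Sum>k<i. of_vec (x (Suc k)) - of_vec (x k))"
    proof (rule sum.cong)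
      fix k assume "k \<in> {..<i}"
      then have "k < length d" using i by simp
      then show "of_real (d ! k) * u k = of_vec (x (Suc k)) - of_vec (x k)"
        using pos[of k] by (simp add: u_def of_vec_diff)
    qed simp
    also have "\<dots> = of_vec (x i - x 0)" 
      using sum_lessThan_telescope[of "\<lambda>k. of_vec (x k)" i] by (simp add: of_vec_diff)
    finally show ?thesis using i by (simp add: place_def)
  qed
  ultimately show ?thesis using that by blast
qed

lemma rooted_configuration_iff:
  assumes d: "free_linkage d"
  shows "x \<in> configurations d \<and> x 0 = 0 \<longleftrightarrow> x \<in> place d ` torus"
proof
  assume x: "x \<in> configurations d \<and> x 0 = 0"
  then obtain u where u: "u \<in> torus" "\<forall>i\<le>length d. x i = x 0 + place d u i"
    using configuration_directions[OF d] by blast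
  have "x = place d u"
  proof (rule extensionalityI[of _ "{0..length d}"])
    show "x \<in> extensional {0..length d}" using x by (auto simp: configurations_def PiE_def)
    show "place d u \<in> extensional {0..length d}" by (simp add: place_def)
  next
    fix i assume "i \<in> {0..length d}"
    then have "x i = x 0 + place d u i" using u(2) by (meson atLeastAtMost_iff)
    then show "x i = place d u i" using x by simp
  qed
  then show "x \<in> place d ` torus" using u(1) by blast
next
  assume "x \<in> place d ` torus"
  then show "x \<in> configurations d \<and> x 0 = 0" using place_configuration[OF d] by auto
qed

lemma continuous_on_endpoint: "continuous_on S (endpoint d)"
  unfolding endpoint_def by (intro continuous_intros)

lemma continuous_map_place: "continuous_map (top_of_set S) (vertex_topology d) (place d)"
proof -
  have "continuous_map (top_of_set S) euclidean (\<lambda>u. place d u i)" if "i \<in> {0..length d}" for i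
  proof -
    have "continuous_on S (\<lambda>u. to_vec (\<Sum>k<i. of_real (d ! k) * u k))"
      by (rule continuous_on_compose2[OF continuous_on_to_vec[of UNIV]]) (intro continuous_intros, simp)
    then show ?thesis using that by (simp add: place_def)
  qed
  then show ?thesis
    unfolding vertex_topology_def continuous_map_componentwise by (auto simp: place_def)
qed

text \<open>
  The attained distances form a compact connected set. It has a minimum, which is therefore the value
  of the \<open>LEAST\<close> in the definition of the length range, and it contains the total length, attained by
  a straight configuration.
\<close>
lemma length_range_attained:
  assumes d: "free_linkage d" and \<rho>: "\<rho> \<in> length_range d"
  obtains u where "u \<in> torus" "norm (endpoint d u) = \<rho>"
proof -
  let ?R = "(\<lambda>u. norm (endpoint d u)) ` torus"
  have cont: "continuous_on torus (\<lambda>u. norm (endpoint d u))"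
    by (intro continuous_on_norm continuous_on_endpoint)
  have R: "(\<exists>x\<in>configurations d. l = dist (x (length d)) (x 0)) \<longleftrightarrow> l \<in> ?R" for l
  proof
    assume "\<exists>x\<in>configurations d. l = dist (x (length d)) (x 0)"
    then obtain x where x: "x \<in> configurations d" "l = dist (x (length d)) (x 0)" by blast
    obtain u where u: "u \<in> torus" "\<forall>i\<le>length d. x i = x 0 + place d u i"
      by (rule configuration_directions[OF d x(1)])
    have "x (length d) = x 0 + to_vec (endpoint d u)" using u(2)[rule_format, of "length d"] by simp
    then have "l = norm (endpoint d u)" using x(2) by (simp add: dist_norm)
    then show "l \<in> ?R" using u(1) by blast
  next
    assume "l \<in> ?R"
    then obtain u where u: "u \<in> torus" "l = norm (endpoint d u)" by blast
    then show "\<exists>x\<in>configurations d. l = dist (x (length d)) (x 0)"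
      using place_configuration[OF d u(1)] by (intro bexI[of _ "place d u"]) simp_all
  qed
  have one: "(\<lambda>_. 1) \<in> torus" by (simp add: torus_def)
  have "compact ?R" by (rule compact_continuous_image[OF cont compact_torus])
  then obtain m where m: "m \<in> ?R" "\<forall>y\<in>?R. m \<le> y"
    using compact_attains_inf[of ?R] one by blast
  have "(LEAST l. \<exists>x\<in>configurations d. l = dist (x (length d)) (x 0)) = m"
    unfolding R by (rule Least_equality) (use m in auto)
  then have "m \<le> \<rho>" "\<rho> \<le> sum_list d" using \<rho> by (simp_all add: length_range_def)
  moreover have "sum_list d \<in> ?R"
  proof -
    have "endpoint d (\<lambda>_. 1) = of_real (sum_list d)"
      by (simp add: endpoint_def sum_list_sum_nth atLeast0LessThan)
    moreover have "0 \<le> sum_list d"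
      using d by (intro sum_list_nonneg) (auto simp: free_linkage_def less_imp_le)
    ultimately have "norm (endpoint d (\<lambda>_. 1)) = sum_list d" by simp
    then show ?thesis using one by (metis imageI)
  qed
  moreover have "connected ?R" by (rule connected_continuous_image[OF cont connected_torus])
  ultimately have "\<rho> \<in> ?R" using connected_contains_Icc[of ?R m "sum_list d"] m(1) by auto
  then show ?thesis using that by auto
qed

lemma chains_rotate:
  assumes "norm c = 1"
  shows "chain_space J l (z * c) = (\<lambda>u k. c * u k) ` chain_space J l z"
proof -
  have sub: "(\<lambda>k. c * u k) \<in> chain_space J l (z * c)" if "norm c = 1" "u \<in> chain_space J l z" for c z u
  proof -
    have "(\<Sum>k\<in>J. of_real (l k) * (c * u k)) = c * (\<Sum>k\<in>J. of_real (l k) * u k)"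
      unfolding sum_distrib_left by (rule sum.cong) simp_all
    then show ?thesis using that by (simp add: chain_space_def torus_def norm_mult)
  qed
  have c0: "c \<noteq> 0" using assms by auto
  show ?thesis
  proof (intro equalityI subsetI)
    fix u assume "u \<in> chain_space J l (z * c)"
    then have "(\<lambda>k. inverse c * u k) \<in> chain_space J l (z * c * inverse c)"
      by (intro sub) (simp_all add: norm_inverse assms)
    moreover have "u = (\<lambda>k. c * (inverse c * u k))" using c0 by (simp add: field_simps)
    ultimately show "u \<in> (\<lambda>u k. c * u k) ` chain_space J l z"
      using c0 by (intro image_eqI[of _ _ "\<lambda>k. inverse c * u k"]) (simp_all add: mult.assoc)
  next
    fix u assume "u \<in> (\<lambda>u k. c * u k) ` chain_space J l z"
    then obtain v where "u = (\<lambda>k. c * v k)" "v \<in> chain_space J l z" by (rule imageE)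
    then show "u \<in> chain_space J l (z * c)" using sub[OF assms, of v z] by simp
  qed
qed

lemma polar:
  fixes z :: complex
  obtains c where "norm c = 1" "z = of_real (norm z) * c"
proof (cases "z = 0")
  case True
  then show ?thesis using that[of 1] by simp
next
  case False
  then show ?thesis using that[of "z / of_real (norm z)"] by (simp add: norm_divide)
qed

lemma connected_chains_complex:
  assumes "finite J" "\<And>k. k \<in> J \<Longrightarrow> 0 \<le> l k" "no_long_triple J l (norm z)"
  shows "connected (chain_space J l z)"
proof -
  obtain c where c: "norm c = 1" "z = of_real (norm z) * c" by (rule polar)
  have "connected ((\<lambda>u k. c * u k) ` chain_space J l (of_real (norm z)))"
  proof (rule connected_continuous_image)
    show "continuous_on (chain_space J l (of_real (norm z))) (\<lambda>u k. c * u k)"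
      by (rule continuous_on_coordinatewise_then_product) (intro continuous_intros)
    show "connected (chain_space J l (of_real (norm z)))"
      by (rule connected_chains) (use assms in auto)
  qed
  then show ?thesis using chains_rotate[OF c(1), of J l "of_real (norm z)"] c(2) by simp
qed

lemma chains_nonempty:
  assumes d: "free_linkage d" and z: "norm z \<in> length_range d"
  shows "chain_space {..<length d} ((!) d) z \<noteq> {}"
proof -
  obtain u where u: "u \<in> torus" "norm (endpoint d u) = norm z"
    by (rule length_range_attained[OF d z])
  obtain c where c: "norm c = 1" "z = of_real (norm z) * c" by (rule polar)
  obtain e where e: "norm e = 1" "endpoint d u = of_real (norm (endpoint d u)) * e" by (rule polar)
  have e0: "e \<noteq> 0" using e(1) by auto
  have "norm (c / e) = 1" using c e by (simp add: norm_divide)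
  from chains_rotate[OF this, of "{..<length d}" "(!) d" "endpoint d u"]
  have "chain_space {..<length d} ((!) d) (endpoint d u * (c / e)) \<noteq> {}"
    using u(1) by (auto simp: chain_space_def endpoint_def)
  moreover have "endpoint d u * (c / e) = z" using c(2) e(2) u(2) e0 by (simp add: field_simps)
  ultimately show ?thesis by simp
qed

definition coupled_chains :: "real list \<Rightarrow> real list \<Rightarrow> real list \<Rightarrow>
    ((nat \<Rightarrow> complex) \<times> (nat \<Rightarrow> complex) \<times> (nat \<Rightarrow> complex)) set" where
  "coupled_chains d1 d2 d3 = {(u, v, w). u \<in> torus \<and>
     v \<in> chain_space {..<length d2} ((!) d2) (endpoint d1 u) \<and>
     w \<in> chain_space {..<length d3} ((!) d3) (endpoint d1 u)}"

text \<open>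
  Over a configuration of the first linkage the fibre is a product of two chain spaces.
\<close>
lemma connected_coupled_chains:
  assumes "\<And>u. u \<in> torus \<Longrightarrow> connected (chain_space {..<length d2} ((!) d2) (endpoint d1 u))"
    and "\<And>u. u \<in> torus \<Longrightarrow> connected (chain_space {..<length d3} ((!) d3) (endpoint d1 u))"
    and "\<And>u. u \<in> torus \<Longrightarrow> chain_space {..<length d2} ((!) d2) (endpoint d1 u) \<noteq> {}"
    and "\<And>u. u \<in> torus \<Longrightarrow> chain_space {..<length d3} ((!) d3) (endpoint d1 u) \<noteq> {}"
  shows "connected (coupled_chains d1 d2 d3)"
proof -
  let ?K = "coupled_chains d1 d2 d3"
  have K: "compact ?K"
  proof -
    have "closed {x :: (nat \<Rightarrow> complex) \<times> (nat \<Rightarrow> complex) \<times> (nat \<Rightarrow> complex).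
        endpoint d2 (fst (snd x)) = endpoint d1 (fst x) \<and> endpoint d3 (snd (snd x)) = endpoint d1 (fst x)}"
      unfolding endpoint_def by (intro closed_Collect_conj closed_Collect_eq continuous_intros)
    then have "compact ((torus \<times> torus \<times> torus) \<inter> {x.
        endpoint d2 (fst (snd x)) = endpoint d1 (fst x) \<and> endpoint d3 (snd (snd x)) = endpoint d1 (fst x)})"
      by (intro compact_Int_closed compact_Times compact_torus)
    also have "(torus \<times> torus \<times> torus) \<inter> {x.
        endpoint d2 (fst (snd x)) = endpoint d1 (fst x) \<and> endpoint d3 (snd (snd x)) = endpoint d1 (fst x)} = ?K"
      by (auto simp: coupled_chains_def chain_space_def endpoint_def)
    finally show ?thesis .
  qed
  have "connected_modulo {} ?K"
  proof (rule connected_modulo_fibration[where f = fst and H = "{}" and F = "{}"])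
    show "compact ?K" by (rule K)
    show "continuous_on ?K fst" by (intro continuous_on_fst continuous_on_id)
    have "fst ` ?K = torus" using assms(3,4) by (force simp: coupled_chains_def image_iff)
    then show "connected_modulo {} (fst ` ?K)"
      using connected_torus compact_imp_closed[OF compact_torus]
      by (simp add: connected_modulo_empty_iff)
  next
    fix u assume "u \<in> fst ` ?K"
    then have u: "u \<in> torus" by (auto simp: coupled_chains_def)
    have "{x \<in> ?K. fst x = u} = {u} \<times> chain_space {..<length d2} ((!) d2) (endpoint d1 u) \<times>
        chain_space {..<length d3} ((!) d3) (endpoint d1 u)" (is "_ = ?F")
      using u by (auto simp: coupled_chains_def)
    moreover have "connected ?F"
      by (intro connected_Times connected_sing assms(1,2) u)
    moreover have "closed ?F"
      by (intro closed_Times closed_singleton compact_imp_closed compact_chains)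
    ultimately show "connected_modulo {} {x \<in> ?K. fst x = u}"
      by (simp add: connected_modulo_empty_iff)
  qed auto
  then show ?thesis using compact_imp_closed[OF K] by (simp add: connected_modulo_empty_iff)
qed

lemma C_set_eq_image:
  assumes "free_linkage d1" "free_linkage d2" "free_linkage d3"
  shows "C_set d1 d2 d3 = (\<lambda>(u, v, w). (place d1 u, place d2 v, place d3 w)) ` coupled_chains d1 d2 d3"
    (is "_ = ?f ` _")
proof (intro equalityI subsetI)
  fix t assume "t \<in> C_set d1 d2 d3"
  then obtain x y z where t: "t = (x, y, z)" "x \<in> configurations d1 \<and> x 0 = 0"
    "y \<in> configurations d2 \<and> y 0 = 0" "z \<in> configurations d3 \<and> z 0 = 0"
    "x (length d1) = y (length d2)" "y (length d2) = z (length d3)"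
    by (auto simp: C_set_def)
  have "x \<in> place d1 ` torus" "y \<in> place d2 ` torus" "z \<in> place d3 ` torus"
    using t(2-4) assms by (simp_all only: rooted_configuration_iff[symmetric])
  then obtain u v w where uvw: "u \<in> torus" "v \<in> torus" "w \<in> torus"
    "x = place d1 u" "y = place d2 v" "z = place d3 w"
    by blast
  have "to_vec (endpoint d2 v) = to_vec (endpoint d1 u)" "to_vec (endpoint d3 w) = to_vec (endpoint d1 u)"
    using t(5,6) by (simp_all add: uvw(4-6))
  then have "endpoint d2 v = endpoint d1 u" "endpoint d3 w = endpoint d1 u"
    by (blast intro: to_vec_inj)+
  then have "(u, v, w) \<in> coupled_chains d1 d2 d3"
    using uvw by (simp add: coupled_chains_def chain_space_def endpoint_def)
  then show "t \<in> ?f ` coupled_chains d1 d2 d3"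
    by (rule image_eqI[rotated]) (simp add: t(1) uvw)
next
  fix t assume "t \<in> ?f ` coupled_chains d1 d2 d3"
  then obtain u v w where t: "t = (place d1 u, place d2 v, place d3 w)"
    "u \<in> torus" "v \<in> torus" "w \<in> torus" "endpoint d2 v = endpoint d1 u" "endpoint d3 w = endpoint d1 u"
    by (auto simp: coupled_chains_def chain_space_def endpoint_def)
  then show "t \<in> C_set d1 d2 d3"
    using assms by (simp add: C_set_def place_configuration)
qed

lemma connected_M_space:
  assumes free: "free_linkage d1" "free_linkage d2" "free_linkage d3"
    and conn: "connected (coupled_chains d1 d2 d3)"
  shows "connected_space (M_space d1 d2 d3)"
proof -
  let ?K = "coupled_chains d1 d2 d3"
  let ?f = "\<lambda>(u, v, w). (place d1 u, place d2 v, place d3 w)"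
  let ?Z = "prod_topology (vertex_topology d1) (prod_topology (vertex_topology d2) (vertex_topology d3))"
  have coord: "continuous_map (top_of_set ?K) (vertex_topology d) (\<lambda>x. place d (g x))"
    if "continuous_on ?K g" for d and g :: "_ \<Rightarrow> nat \<Rightarrow> complex"
  proof -
    have "continuous_map (top_of_set ?K) (top_of_set UNIV) g" using that by simp
    from continuous_map_compose[OF this continuous_map_place] show ?thesis by (simp add: o_def)
  qed
  have "continuous_map (top_of_set ?K) ?Z ?f"
    unfolding case_prod_unfold continuous_map_pairwise o_def fst_conv snd_conv
    by (intro conjI coord continuous_on_fst continuous_on_snd continuous_on_id)
  moreover have "connectedin (top_of_set ?K) ?K"
    using conn by (simp add: connectedin_subtopology)
  ultimately have "connectedin ?Z (?f ` ?K)" by (rule connectedin_continuous_map_image)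
  then have "connected_space (C_space d1 d2 d3)"
    by (simp add: C_space_def C_set_eq_image[OF free] connectedin_def)
  then show ?thesis
    unfolding M_space_def
    using connected_space_quotient_map_image[OF quotient_map_quotient_topology] by blast
qed

text \<open>
  Any two edges have total length at most that of the two longest ones, so every pair of edges of \<open>r\<close> is
  short.
\<close>
lemma no_long_triple_of_two_longest:
  assumes "two_longest_edges r i j" "r ! i + r ! j \<le> (\<rho>\<^sub>0 + (\<Sum>k<length r. r ! k)) / 2" "\<rho>\<^sub>0 \<le> \<rho>"
  shows "no_long_triple {..<length r} ((!) r) \<rho>"
proof -
  have "r ! k + r ! m \<le> r ! i + r ! j" if "k < length r" "m < length r" "k \<noteq> m" for k m
    using assms(1) that unfolding two_longest_edges_def
    by (cases "k = i \<or> k = j"; cases "m = i \<or> m = j") (force intro: add_mono simp: add.commute)+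
  then show ?thesis
    using assms(2,3) unfolding no_long_triple_def Let_def by force
qed

theorem theorem5p14:
  fixes a b P' P'' :: real and r r' :: "real list" and i j i' j' :: nat
  assumes "0 < a" and "0 < b"
    and "free_linkage r" and "2 \<le> length r"
    and "free_linkage r'" and "2 \<le> length r'"
    and "{\<bar>a - b\<bar>..a + b} \<subseteq> length_range r"
    and "{\<bar>a - b\<bar>..a + b} \<subseteq> length_range r'"
    and "P' = \<bar>a - b\<bar> + (\<Sum>k<length r. r ! k)"
    and "P'' = \<bar>a - b\<bar> + (\<Sum>k<length r'. r' ! k)"
    and "two_longest_edges r i j"
    and "two_longest_edges r' i' j'"
    and "r ! i + r ! j \<le> P' / 2"
    and "r' ! i' + r' ! j' \<le> P'' / 2"
  shows "connected_space (M_space [a, b] r r')"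
proof (rule connected_M_space)
  show "free_linkage [a, b]" using assms(1,2) by (simp add: free_linkage_def)
  show "free_linkage r" "free_linkage r'" by fact+
  have bounds: "\<bar>a - b\<bar> \<le> norm (endpoint [a, b] u)" "norm (endpoint [a, b] u) \<le> a + b"
    if "u \<in> torus" for u
  proof -
    have e: "endpoint [a, b] u = of_real a * u 0 + of_real b * u 1"
      by (simp add: endpoint_def numeral_2_eq_2)
    have n: "norm (of_real a * u 0) = a" "norm (of_real b * u 1) = b"
      using that assms(1,2) by (simp_all add: torus_def norm_mult)
    show "norm (endpoint [a, b] u) \<le> a + b"
      unfolding e using norm_triangle_ineq[of "of_real a * u 0" "of_real b * u 1"] n by simp
    show "\<bar>a - b\<bar> \<le> norm (endpoint [a, b] u)"
      unfolding e using norm_triangle_ineq3[of "of_real a * u 0" "- (of_real b * u 1)"] n by simp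
  qed
  have fibre: "connected (chain_space {..<length s} ((!) s) (endpoint [a, b] u))"
      "chain_space {..<length s} ((!) s) (endpoint [a, b] u) \<noteq> {}"
    if s: "free_linkage s" "{\<bar>a - b\<bar>..a + b} \<subseteq> length_range s" "two_longest_edges s k m"
      "s ! k + s ! m \<le> (\<bar>a - b\<bar> + (\<Sum>k<length s. s ! k)) / 2" and u: "u \<in> torus"
    for s k m u
  proof -
    show "connected (chain_space {..<length s} ((!) s) (endpoint [a, b] u))"
    proof (rule connected_chains_complex)
      show "no_long_triple {..<length s} ((!) s) (norm (endpoint [a, b] u))"
        by (rule no_long_triple_of_two_longest[OF s(3,4) bounds(1)[OF u]])
    qed (use s(1) in \<open>auto simp: free_linkage_def less_imp_le\<close>)
    show "chain_space {..<length s} ((!) s) (endpoint [a, b] u) \<noteq> {}"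
      by (rule chains_nonempty[OF s(1)]) (use bounds[OF u] s(2) in auto)
  qed
  note fibre_r = fibre[OF assms(3,7,11) assms(13)[unfolded assms(9)]]
    and fibre_r' = fibre[OF assms(5,8,12) assms(14)[unfolded assms(10)]]
  show "connected (coupled_chains [a, b] r r')"
    by (rule connected_coupled_chains) (fact fibre_r fibre_r')+
qed

end
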